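(* Let $n\ge 1$ be an integer and $N=n^2+2n-2$. Then: (i) For every $k\ge N$, $s_k=s_k^{\mathrm{rsym.r}}$ on $\mathrm{Vect}(n)$, i.e. $s_k(X_1,\ldots,X_k)=s_k^{\mathrm{rsym.r}}(X_1,\ldots,X_k)$ for all $X_1,\ldots,X_k\in \mathrm{Vect}(n)$. In particular, $s_k$ is well defined on $\mathrm{Vect}(n)$ if $k\ge N$, i.e. $s_k(X_1,\ldots,X_k)\in \mathrm{Vect}(n)$ for all $X_1,\ldots,X_k\in \mathrm{Vect}(n)$. (ii) For every $k>N+1$, $s_k=0$ is an identity on $\mathrm{Vect}(n)$, i.e. $s_k(X_1,\ldots,X_k)=0$ for all $X_1,\ldots,X_k\in\mathrm{Vect}(n)$. (iii) If $n>1$, then the algebra $(\mathrm{Vect}(n),s_N)$ is $(N-1)$-left commutative. In particular, $(\mathrm{Vect}(n),s_N)$ is $N$-homotopical Lie. (iv) For every $X\in \mathrm{Vect}(n)$ and every $k\ge N$, $\mathrm{ad}\,X$ is a derivation of the $k$-algebra $(\mathrm{Vect}(n),s_k)$. (v) For every integer $k>0$ and every $X=\sum_l u_l\partial_l\in \mathrm{Vect}(n)$ such that $\partial_i\partial_j(u_l)=0$ for all $i,j,l\in\{1,\ldots,n\}$, $\mathrm{ad}\,X$ is a derivation of the $k$-algebra $(\mathrm{Vect}(n),s_k^{\mathrm{rsym.r}})$.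
   Context: Let $U=\mathbb{C}[x_1,\ldots,x_n]$, $\partial_i=\partial/\partial x_i$, and let $\mathrm{Diff}(n)$ be the space of all finite sums $\sum_{\alpha\in\mathbb{Z}_{\ge0}^n}u_\alpha\partial^\alpha$, $u_\alpha\in U$, $\partial^\alpha=\prod_i\partial_i^{\alpha_i}$ (differential operators). Operators are written as acting on the right: $(f)X$ is the result of applying $X$ to $f$, and the associative product $X\cdot Y$ on $\mathrm{Diff}(n)$ is composition in the order "first $X$, then $Y$", $(f)(X\cdot Y)=((f)X)Y$; thus $u\partial_i\cdot v\partial_j=v\,\partial_j(u)\,\partial_i+uv\,\partial_i\partial_j$. $\mathrm{Vect}(n)=\{\sum_i u_i\partial_i: u_i\in U\}\subseteq\mathrm{Diff}(n)$. Put $[X,Y]=X\cdot Y-Y\cdot X$ and $(Y)\,\mathrm{ad}\,X=[Y,X]$. $s_k(X_1,\ldots,X_k)=\sum_{\sigma\in \mathrm{Sym}_k}\mathrm{sign}(\sigma)\,X_{\sigma(1)}\cdot X_{\sigma(2)}\cdots X_{\sigma(k)}$, computed in $\mathrm{Diff}(n)$. The right-symmetric multiplication $\circ$ on $\mathrm{Vect}(n)$ is the bilinear operation $u\partial_i\circ v\partial_j=v\,\partial_j(u)\,\partial_i$, and $$s_k^{\mathrm{rsym.r}}(X_1,\ldots,X_k)=\sum_{\sigma\in \mathrm{Sym}_k}\mathrm{sign}(\sigma)\,(\cdots((X_{\sigma(1)}\circ X_{\sigma(2)})\circ X_{\sigma(3)})\cdots)\circ X_{\sigma(k)}.$$ For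 a $k$-linear operation $\omega$ on a vector space $A$, a linear map $D:A\to A$ is a derivation of the $k$-algebra $(A,\omega)$ if $D(\omega(a_1,\ldots,a_k))=\sum_{i=1}^k\omega(a_1,\ldots,a_{i-1},D(a_i),a_{i+1},\ldots,a_k)$ for all $a_i\in A$. For a skew-symmetric $m$-linear operation $\omega$ on $A$, $(A,\omega)$ is $(m-1)$-left commutative if $$\sum_{\sigma\in \mathrm{Sym}_{2m-2}}\mathrm{sign}(\sigma)\,\omega(a_{\sigma(1)},\ldots,a_{\sigma(m-1)},\omega(a_{\sigma(m)},\ldots,a_{\sigma(2m-2)},a_{2m-1}))=0$$ for all $a_1,\ldots,a_{2m-1}\in A$, and $m$-homotopical Lie if $$\sum_{\sigma\in \mathrm{Sym}_{2m-1}}\mathrm{sign}(\sigma)\,\omega(a_{\sigma(1)},\ldots,a_{\sigma(m-1)},\omega(a_{\sigma(m)},\ldots,a_{\sigma(2m-2)},a_{\sigma(2m-1)}))=0$$ for all $a_1,\ldots,a_{2m-1}\in A$. *)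

theory Defs
  imports
    Complex_Main
    "HOL-Library.Cardinality"
    "HOL-Library.Poly_Mapping"
    "HOL-Combinatorics.Permutations"
begin

section \<open>Polynomials and partial derivatives\<close>

text \<open>The variables are indexed by a finite type \<open>'n\<close>, so that \<open>n = CARD('n) \<ge> 1\<close>. A monomial is
  its exponent vector, and a polynomial is a finitely supported family of coefficients.\<close>

type_synonym 'n U = "('n \<Rightarrow>\<^sub>0 nat) \<Rightarrow>\<^sub>0 complex"

definition const :: "complex \<Rightarrow> 'n U" where
  "const c = Poly_Mapping.single 0 c"

definition var :: "'n \<Rightarrow> 'n U" where
  "var i = Poly_Mapping.single (Poly_Mapping.single i 1) 1"

text \<open>The subtraction of exponents is truncated; where it matters, the coefficient is \<open>0\<close>.\<close>

definition pd :: "'n \<Rightarrow> 'n U \<Rightarrow> 'n U" where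
  "pd i p = (\<Sum>m\<in>Poly_Mapping.keys p. Poly_Mapping.single (m - Poly_Mapping.single i 1)
                              (of_nat (Poly_Mapping.lookup m i) * Poly_Mapping.lookup p m))"

lemma pd_superset:
  assumes "finite S" "Poly_Mapping.keys p \<subseteq> S"
  shows "pd i p = (\<Sum>m\<in>S. Poly_Mapping.single (m - Poly_Mapping.single i 1)
                              (of_nat (Poly_Mapping.lookup m i) * Poly_Mapping.lookup p m))"
  unfolding pd_def
  by (rule sum.mono_neutral_left) (use assms in \<open>auto simp: in_keys_iff\<close>)

lemma pd_0 [simp]: "pd i 0 = 0"
  by (simp add: pd_def)

lemma pd_add: "pd i (p + q) = pd i p + pd i q"
proof -
  let ?S = "Poly_Mapping.keys p \<union> Poly_Mapping.keys q"
  have "Poly_Mapping.keys (p + q) \<subseteq> ?S" by (rule Poly_Mapping.keys_add)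
  then show ?thesis
    by (simp add: pd_superset[of ?S] lookup_add distrib_left single_add sum.distrib)
qed

lemma pd_sum: "pd i (sum f A) = (\<Sum>a\<in>A. pd i (f a))"
  by (induction A rule: infinite_finite_induct) (simp_all add: pd_add)

lemma pd_single:
  "pd i (Poly_Mapping.single m c)
     = Poly_Mapping.single (m - Poly_Mapping.single i 1) (of_nat (Poly_Mapping.lookup m i) * c)"
  by (cases "c = 0") (simp_all add: pd_def)

lemma pd_var: "pd i (var j) = (if i = j then 1 else 0)"
  by (simp add: var_def pd_single lookup_single)

lemma sum_single: "p = (\<Sum>m\<in>Poly_Mapping.keys p. Poly_Mapping.single m (Poly_Mapping.lookup p m))"
proof (rule poly_mapping_eqI)
  fix k
  have "(\<Sum>m\<in>Poly_Mapping.keys p. Poly_Mapping.lookup (Poly_Mapping.single m (Poly_Mapping.lookup p m)) k)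
          = (\<Sum>m\<in>Poly_Mapping.keys p. if m = k then Poly_Mapping.lookup p m else 0)"
    by (rule sum.cong) (auto simp: lookup_single)
  also have "\<dots> = Poly_Mapping.lookup p k"
    by (simp add: in_keys_iff)
  finally show "Poly_Mapping.lookup p k = Poly_Mapping.lookup (\<Sum>m\<in>Poly_Mapping.keys p. Poly_Mapping.single m (Poly_Mapping.lookup p m)) k"
    by (simp add: lookup_sum)
qed

lemma pd_mult_single:
  fixes c d :: complex
  shows "pd i (Poly_Mapping.single m c * Poly_Mapping.single k d)
           = pd i (Poly_Mapping.single m c) * Poly_Mapping.single k d
             + Poly_Mapping.single m c * pd i (Poly_Mapping.single k d)"
proof -
  let ?e = "Poly_Mapping.single i (1::nat)"
  have a: "m - ?e + k = m + k - ?e" if "Poly_Mapping.lookup m i \<noteq> 0" for m k :: "'a \<Rightarrow>\<^sub>0 nat"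
    by (rule poly_mapping_eqI) (use that in \<open>auto simp: lookup_add lookup_minus lookup_single when_def\<close>)
  have 1: "Poly_Mapping.single (m - ?e + k) (of_nat (Poly_Mapping.lookup m i) * c * d)
           = Poly_Mapping.single (m + k - ?e) (of_nat (Poly_Mapping.lookup m i) * c * d)"
    using a[of m k] by (cases "Poly_Mapping.lookup m i = 0") simp_all
  have 2: "Poly_Mapping.single (m + (k - ?e)) (c * (of_nat (Poly_Mapping.lookup k i) * d))
           = Poly_Mapping.single (m + k - ?e) (c * (of_nat (Poly_Mapping.lookup k i) * d))"
    using a[of k m] by (cases "Poly_Mapping.lookup k i = 0") (simp_all add: add.commute)
  have "pd i (Poly_Mapping.single m c * Poly_Mapping.single k d)
      = Poly_Mapping.single (m + k - ?e) (of_nat (Poly_Mapping.lookup m i) * c * d)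
        + Poly_Mapping.single (m + k - ?e) (c * (of_nat (Poly_Mapping.lookup k i) * d))"
    by (simp add: pd_single mult_single lookup_add algebra_simps flip: single_add)
  also have "\<dots> = pd i (Poly_Mapping.single m c) * Poly_Mapping.single k d
             + Poly_Mapping.single m c * pd i (Poly_Mapping.single k d)"
    by (simp only: pd_single mult_single 1 2)
  finally show ?thesis .
qed

lemma pd_mult: "pd i (p * q) = pd i p * q + p * pd i q"
proof -
  let ?s = "\<lambda>p m. Poly_Mapping.single m (Poly_Mapping.lookup p m)"
  have pq: "p = (\<Sum>m\<in>Poly_Mapping.keys p. ?s p m)" "q = (\<Sum>m\<in>Poly_Mapping.keys q. ?s q m)"
    by (rule sum_single)+
  have 1: "pd i ((\<Sum>m\<in>A. f m) * (\<Sum>m\<in>B. g m))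
        = pd i (\<Sum>m\<in>A. f m) * (\<Sum>m\<in>B. g m) + (\<Sum>m\<in>A. f m) * pd i (\<Sum>m\<in>B. g m)"
    if "\<And>m k. pd i (f m * g k) = pd i (f m) * g k + f m * pd i (g k)" for f g A B
    by (simp add: pd_sum sum_product that sum.distrib)
  show ?thesis
    by (subst (1 3) pq(1), subst (1 3) pq(2), subst 1)
       (simp_all add: pd_mult_single flip: pq)
qed

lemma pd_commute: "pd i (pd j p) = pd j (pd i p)"
proof -
  have "pd i (pd j (Poly_Mapping.single m c)) = pd j (pd i (Poly_Mapping.single m c))" for m c
    by (cases "i = j") (simp_all add: pd_single lookup_minus lookup_single diff_diff_eq add.commute
                          mult.left_commute)
  then have "pd i (pd j (\<Sum>m\<in>Poly_Mapping.keys p. Poly_Mapping.single m (Poly_Mapping.lookup p m)))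
           = pd j (pd i (\<Sum>m\<in>Poly_Mapping.keys p. Poly_Mapping.single m (Poly_Mapping.lookup p m)))"
    by (simp add: pd_sum)
  then show ?thesis by (simp flip: sum_single)
qed

lemma pd_funpow_commute: "(pd i ^^ a) (pd j p) = pd j ((pd i ^^ a) p)"
  by (induction a) (simp_all add: pd_commute)

lemma pd_funpow_funpow_commute: "(pd i ^^ a) ((pd j ^^ b) p) = (pd j ^^ b) ((pd i ^^ a) p)"
  by (induction b) (simp_all add: pd_funpow_commute)

lemma pd_const_mult: "pd i (const c * p) = const c * pd i p"
  by (simp add: pd_mult const_def pd_single)


section \<open>Differential operators\<close>

text \<open>\<open>pd_pow_on A \<alpha>\<close> is the composition of all \<open>pd i ^^ \<alpha> i\<close> with \<open>i \<in> A\<close>; the order is irrelevant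
  as partial derivatives commute.\<close>

definition pd_pow_on :: "'n set \<Rightarrow> ('n \<Rightarrow>\<^sub>0 nat) \<Rightarrow> 'n U \<Rightarrow> 'n U" where
  "pd_pow_on A \<alpha> = Finite_Set.fold (\<lambda>i g. (pd i ^^ Poly_Mapping.lookup \<alpha> i) \<circ> g) id A"

abbreviation pd_pow :: "('n::finite \<Rightarrow>\<^sub>0 nat) \<Rightarrow> 'n U \<Rightarrow> 'n U" where
  "pd_pow \<equiv> pd_pow_on UNIV"

lemma pd_pow_on_empty [simp]: "pd_pow_on {} \<alpha> f = f"
  by (simp add: pd_pow_on_def)

lemma pd_pow_on_insert [simp]:
  assumes "finite A" "i \<notin> A"
  shows "pd_pow_on (insert i A) \<alpha> f = (pd i ^^ Poly_Mapping.lookup \<alpha> i) (pd_pow_on A \<alpha> f)"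
proof -
  interpret comp_fun_commute "\<lambda>i g. (pd i ^^ Poly_Mapping.lookup \<alpha> i) \<circ> g"
    by unfold_locales (auto simp: fun_eq_iff pd_funpow_funpow_commute)
  show ?thesis
    unfolding pd_pow_on_def fold_insert[OF assms] by (rule comp_apply)
qed

lemma pd_pow_on_cong:
  assumes "finite A" "\<And>i. i \<in> A \<Longrightarrow> Poly_Mapping.lookup \<alpha> i = Poly_Mapping.lookup \<beta> i"
  shows "pd_pow_on A \<alpha> f = pd_pow_on A \<beta> f"
  using assms by (induction A) simp_all

lemma pd_pow_0: "pd_pow 0 f = f"
proof -
  have "pd_pow_on A 0 f = f" if "finite A" for A
    using that by (induction A) simp_all
  then show ?thesis by simp
qed

lemma pd_pow_plus_single: "pd_pow (\<alpha> + Poly_Mapping.single i 1) f = pd i (pd_pow \<alpha> f)"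
proof -
  let ?A = "UNIV - {i}"
  have "pd_pow_on ?A (\<alpha> + Poly_Mapping.single i 1) f = pd_pow_on ?A \<alpha> f"
    by (rule pd_pow_on_cong) (auto simp: lookup_add lookup_single)
  then have "pd_pow_on (insert i ?A) (\<alpha> + Poly_Mapping.single i 1) f
           = pd i (pd_pow_on (insert i ?A) \<alpha> f)"
    by (simp add: lookup_add del: insert_Diff_single)
  moreover have "insert i ?A = UNIV" by blast
  ultimately show ?thesis by simp
qed

lemma pd_pow_single: "pd_pow (Poly_Mapping.single i 1) = pd i"
  using pd_pow_plus_single[of 0 i] by (simp add: pd_pow_0 fun_eq_iff)

definition Diff_set :: "('n::finite U \<Rightarrow> 'n U) set" where
  "Diff_set = {D. \<exists>S u. finite S \<and> D = (\<lambda>f. \<Sum>\<alpha>\<in>S. u \<alpha> * pd_pow \<alpha> f)}"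

lemma Diff_set_monom: "(\<lambda>f. u * pd_pow \<alpha> f) \<in> Diff_set"
  unfolding Diff_set_def by (intro CollectI exI[of _ "{\<alpha>}"] exI[of _ "\<lambda>_. u"]) simp

lemma Diff_set_0: "(\<lambda>f. 0) \<in> Diff_set"
  using Diff_set_monom[of 0] by simp

lemma Diff_set_id: "(\<lambda>f. f) \<in> Diff_set"
  using Diff_set_monom[of 1 0] by (simp add: pd_pow_0)

lemma Diff_set_pd: "pd i \<in> Diff_set"
  using Diff_set_monom[of 1 "Poly_Mapping.single i 1"] by (simp add: pd_pow_single[simplified])

lemma Diff_set_add:
  assumes "D \<in> Diff_set" "E \<in> Diff_set"
  shows "(\<lambda>f. D f + E f) \<in> Diff_set"
proof -
  from assms obtain S u T v where D: "finite S" "D = (\<lambda>f. \<Sum>\<alpha>\<in>S. u \<alpha> * pd_pow \<alpha> f)"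
    and E: "finite T" "E = (\<lambda>f. \<Sum>\<alpha>\<in>T. v \<alpha> * pd_pow \<alpha> f)"
    unfolding Diff_set_def by blast
  let ?u = "\<lambda>\<alpha>. if \<alpha> \<in> S then u \<alpha> else 0" and ?v = "\<lambda>\<alpha>. if \<alpha> \<in> T then v \<alpha> else 0"
  have "D f = (\<Sum>\<alpha>\<in>S \<union> T. ?u \<alpha> * pd_pow \<alpha> f)" for f
    unfolding D(2) by (rule sum.mono_neutral_cong_left) (use D E in auto)
  moreover have "E f = (\<Sum>\<alpha>\<in>S \<union> T. ?v \<alpha> * pd_pow \<alpha> f)" for f
    unfolding E(2) by (rule sum.mono_neutral_cong_left) (use D E in auto)
  ultimately have "(\<lambda>f. D f + E f) = (\<lambda>f. \<Sum>\<alpha>\<in>S \<union> T. (?u \<alpha> + ?v \<alpha>) * pd_pow \<alpha> f)"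
    by (simp only: sum.distrib distrib_right)
  then show ?thesis
    unfolding Diff_set_def using D(1) E(1)
    by (intro CollectI exI[of _ "S \<union> T"] exI[of _ "\<lambda>\<alpha>. ?u \<alpha> + ?v \<alpha>"]) simp
qed

lemma Diff_set_sum:
  assumes "\<And>a. a \<in> A \<Longrightarrow> D a \<in> Diff_set"
  shows "(\<lambda>f. \<Sum>a\<in>A. D a f) \<in> Diff_set"
  using assms
  by (induction A rule: infinite_finite_induct) (simp_all add: Diff_set_0 Diff_set_add)

lemma Diff_set_lmult:
  assumes "D \<in> Diff_set"
  shows "(\<lambda>f. v * D f) \<in> Diff_set"
proof -
  from assms obtain S u where D: "finite S" "D = (\<lambda>f. \<Sum>\<alpha>\<in>S. u \<alpha> * pd_pow \<alpha> f)"
    unfolding Diff_set_def by blast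
  have "(\<lambda>f. v * D f) = (\<lambda>f. \<Sum>\<alpha>\<in>S. (v * u \<alpha>) * pd_pow \<alpha> f)"
    by (simp add: D(2) sum_distrib_left mult.assoc)
  also have "\<dots> \<in> Diff_set"
    by (intro Diff_set_sum Diff_set_monom)
  finally show ?thesis .
qed

lemma Diff_set_pd_comp:
  assumes "D \<in> Diff_set"
  shows "(\<lambda>f. pd i (D f)) \<in> Diff_set"
proof -
  from assms obtain S u where D: "finite S" "D = (\<lambda>f. \<Sum>\<alpha>\<in>S. u \<alpha> * pd_pow \<alpha> f)"
    unfolding Diff_set_def by blast
  have "(\<lambda>f. pd i (D f)) = (\<lambda>f. \<Sum>\<alpha>\<in>S. pd i (u \<alpha>) * pd_pow \<alpha> f
                                  + u \<alpha> * pd_pow (\<alpha> + Poly_Mapping.single i 1) f)"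
    by (simp only: D(2) pd_sum pd_mult pd_pow_plus_single)
  also have "\<dots> \<in> Diff_set"
    by (intro Diff_set_sum Diff_set_add Diff_set_monom)
  finally show ?thesis .
qed

lemma Diff_set_pd_pow_comp:
  assumes "D \<in> Diff_set"
  shows "(\<lambda>f. pd_pow \<alpha> (D f)) \<in> Diff_set"
proof -
  have *: "(\<lambda>f. (pd i ^^ k) (E f)) \<in> Diff_set" if "E \<in> Diff_set" for i k and E :: "'a U \<Rightarrow> 'a U"
    by (induction k) (simp_all add: that Diff_set_pd_comp)
  have "(\<lambda>f. pd_pow_on A \<alpha> (D f)) \<in> Diff_set" if "finite A" for A
    using that by (induction A) (simp_all add: assms *)
  then show ?thesis by simp
qed

lemma Diff_set_comp:
  assumes "D \<in> Diff_set" "E \<in> Diff_set"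
  shows "(\<lambda>f. E (D f)) \<in> Diff_set"
proof -
  from assms(2) obtain T v where E: "E = (\<lambda>f. \<Sum>\<alpha>\<in>T. v \<alpha> * pd_pow \<alpha> f)"
    unfolding Diff_set_def by blast
  show ?thesis
    unfolding E by (intro Diff_set_sum Diff_set_lmult Diff_set_pd_pow_comp assms(1))
qed

lemma pd_pow_linear:
  "pd_pow \<alpha> (f + g) = pd_pow \<alpha> f + pd_pow \<alpha> g"
  "pd_pow \<alpha> (const c * f) = const c * pd_pow \<alpha> f"
proof -
  have 1: "(pd i ^^ k) (f + g) = (pd i ^^ k) f + (pd i ^^ k) g" for i k and f g :: "'a U"
    by (induction k) (simp_all add: pd_add)
  have 2: "(pd i ^^ k) (const c * f) = const c * (pd i ^^ k) f" for i k and f :: "'a U"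
    by (induction k) (simp_all add: pd_const_mult)
  have "pd_pow_on A \<alpha> (f + g) = pd_pow_on A \<alpha> f + pd_pow_on A \<alpha> g
      \<and> pd_pow_on A \<alpha> (const c * f) = const c * pd_pow_on A \<alpha> f" if "finite A" for A
    using that by (induction A) (simp_all add: 1 2)
  then show "pd_pow \<alpha> (f + g) = pd_pow \<alpha> f + pd_pow \<alpha> g"
    "pd_pow \<alpha> (const c * f) = const c * pd_pow \<alpha> f"
    by simp_all
qed

lemma Diff_set_linear:
  assumes "D \<in> Diff_set"
  shows "D (f + g) = D f + D g" "D (const c * f) = const c * D f"
proof -
  from assms obtain S u where D: "D = (\<lambda>f. \<Sum>\<alpha>\<in>S. u \<alpha> * pd_pow \<alpha> f)"
    unfolding Diff_set_def by blast
  show "D (f + g) = D f + D g" "D (const c * f) = const c * D f"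
    by (simp_all add: D pd_pow_linear distrib_left sum.distrib sum_distrib_left mult.left_commute)
qed

typedef (overloaded) ('n::finite) Diff = "Diff_set :: ('n U \<Rightarrow> 'n U) set"
  morphisms Diff_apply Diff_Abs
  using Diff_set_0 by blast

setup_lifting type_definition_Diff

text \<open>The product is composition of operators acting on the right: first \<open>X\<close>, then \<open>Y\<close>.\<close>

instantiation Diff :: (finite) ring_1
begin

lift_definition zero_Diff :: "'a Diff" is "\<lambda>f. 0" by (rule Diff_set_0)
lift_definition one_Diff :: "'a Diff" is "\<lambda>f. f" by (rule Diff_set_id)
lift_definition plus_Diff :: "'a Diff \<Rightarrow> 'a Diff \<Rightarrow> 'a Diff" is "\<lambda>X Y f. X f + Y f"
  by (rule Diff_set_add)
lift_definition uminus_Diff :: "'a Diff \<Rightarrow> 'a Diff" is "\<lambda>X f. - X f"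
  using Diff_set_lmult[of _ "- 1"] by simp
lift_definition minus_Diff :: "'a Diff \<Rightarrow> 'a Diff \<Rightarrow> 'a Diff" is "\<lambda>X Y f. X f - Y f"
  using Diff_set_add Diff_set_lmult[of _ "- 1"] by fastforce
lift_definition times_Diff :: "'a Diff \<Rightarrow> 'a Diff \<Rightarrow> 'a Diff" is "\<lambda>X Y f. Y (X f)"
  by (rule Diff_set_comp)

instance
  by (standard; transfer) (auto simp: fun_eq_iff Diff_set_linear intro: exI[of _ 1])

end

lift_definition scaleD :: "complex \<Rightarrow> 'n::finite Diff \<Rightarrow> 'n Diff" is "\<lambda>c X f. const c * X f"
  by (rule Diff_set_lmult)

interpretation Diff: vector_space scaleD
  by (standard; transfer)
     (simp_all add: fun_eq_iff const_def mult_single single_add distrib_left distrib_right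
        flip: mult.assoc)


section \<open>Polynomial vector fields\<close>

lift_definition vf :: "('n::finite \<Rightarrow> 'n U) \<Rightarrow> 'n Diff" is "\<lambda>u f. \<Sum>i\<in>UNIV. u i * pd i f"
  by (intro Diff_set_sum Diff_set_lmult Diff_set_pd)

definition Vect :: "'n::finite Diff set" where
  "Vect = range vf"

definition vcoeff :: "'n::finite Diff \<Rightarrow> 'n \<Rightarrow> 'n U" where
  "vcoeff X i = Diff_apply X (var i)"

lemma vcoeff_vf [simp]: "vcoeff (vf u) = u"
  by (simp add: vcoeff_def vf.rep_eq pd_var fun_eq_iff if_distrib cong: if_cong)

definition rsym :: "'n::finite Diff \<Rightarrow> 'n Diff \<Rightarrow> 'n Diff" where
  "rsym X Y = vf (\<lambda>i. \<Sum>j\<in>UNIV. vcoeff Y j * pd j (vcoeff X i))"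

lemma rsym_vf: "rsym (vf u) (vf v) = vf (\<lambda>i. \<Sum>j\<in>UNIV. v j * pd j (u i))"
  by (simp add: rsym_def)

definition comm :: "'n::finite Diff \<Rightarrow> 'n Diff \<Rightarrow> 'n Diff" where
  "comm X Y = X * Y - Y * X"

definition ad :: "'n::finite Diff \<Rightarrow> 'n Diff \<Rightarrow> 'n Diff" where
  "ad X Y = comm Y X"


section \<open>Skew-symmetric sums\<close>

text \<open>A \<open>k\<close>-ary operation is a function on lists, used on lists of length \<open>k\<close>. The arity of the
  following two operations is the length of the list, whose positions are numbered from \<open>0\<close>.\<close>

definition s_std :: "'n::finite Diff list \<Rightarrow> 'n Diff" where
  "s_std Xs = (\<Sum>\<sigma> | \<sigma> permutes {..<length Xs}. of_int (sign \<sigma>) * prod_list (permute_list \<sigma> Xs))"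

fun left_normed :: "('a \<Rightarrow> 'a \<Rightarrow> 'a) \<Rightarrow> 'a::zero list \<Rightarrow> 'a" where
  "left_normed m [] = 0"
| "left_normed m (x # xs) = foldl m x xs"

definition s_rsym :: "'n::finite Diff list \<Rightarrow> 'n Diff" where
  "s_rsym Xs =
     (\<Sum>\<sigma> | \<sigma> permutes {..<length Xs}. of_int (sign \<sigma>) * left_normed rsym (permute_list \<sigma> Xs))"


section \<open>Algebras with a \<open>k\<close>-linear operation\<close>

text \<open>The underlying space is a subspace \<open>A\<close> of a complex vector space with scalar
  multiplication \<open>sc\<close>.\<close>

definition linear_map_on ::
    "(complex \<Rightarrow> 'a::ab_group_add \<Rightarrow> 'a) \<Rightarrow> 'a set \<Rightarrow> ('a \<Rightarrow> 'a) \<Rightarrow> bool" where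
  "linear_map_on sc A D \<longleftrightarrow>
     D ` A \<subseteq> A \<and> (\<forall>x\<in>A. \<forall>y\<in>A. D (x + y) = D x + D y) \<and> (\<forall>c. \<forall>x\<in>A. D (sc c x) = sc c (D x))"

definition k_algebra ::
    "(complex \<Rightarrow> 'a::ab_group_add \<Rightarrow> 'a) \<Rightarrow> 'a set \<Rightarrow> nat \<Rightarrow> ('a list \<Rightarrow> 'a) \<Rightarrow> bool" where
  "k_algebra sc A k \<omega> \<longleftrightarrow>
     module.subspace sc A \<and>
     (\<forall>as. length as = k \<and> set as \<subseteq> A \<longrightarrow>
        \<omega> as \<in> A \<and> (\<forall>i<k. linear_map_on sc A (\<lambda>x. \<omega> (as[i := x]))))"

definition derivation_on ::
    "(complex \<Rightarrow> 'a::ab_group_add \<Rightarrow> 'a) \<Rightarrow> 'a set \<Rightarrow> nat \<Rightarrow> ('a list \<Rightarrow> 'a) \<Rightarrow> ('a \<Rightarrow> 'a) \<Rightarrow> bool" where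
  "derivation_on sc A k \<omega> D \<longleftrightarrow>
     k_algebra sc A k \<omega> \<and> linear_map_on sc A D \<and>
     (\<forall>as. length as = k \<and> set as \<subseteq> A \<longrightarrow> D (\<omega> as) = (\<Sum>i<k. \<omega> (as[i := D (as ! i)])))"

definition skew_symmetric_on ::
    "(complex \<Rightarrow> 'a::ab_group_add \<Rightarrow> 'a) \<Rightarrow> 'a set \<Rightarrow> nat \<Rightarrow> ('a list \<Rightarrow> 'a) \<Rightarrow> bool" where
  "skew_symmetric_on sc A k \<omega> \<longleftrightarrow>
     (\<forall>as \<sigma>. length as = k \<and> set as \<subseteq> A \<and> \<sigma> permutes {..<k} \<longrightarrow>
        \<omega> (permute_list \<sigma> as) = sc (of_int (sign \<sigma>)) (\<omega> as))"

text \<open>\<open>left_commutative sc A m \<omega>\<close> says that the \<open>m\<close>-ary algebra \<open>(A, \<omega>)\<close> is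
  \<open>(m - 1)\<close>-left commutative. Here the arguments \<open>a 1, \<dots>, a (2 * m - 1)\<close> are numbered from \<open>1\<close>.\<close>

definition left_commutative ::
    "(complex \<Rightarrow> 'a::ab_group_add \<Rightarrow> 'a) \<Rightarrow> 'a set \<Rightarrow> nat \<Rightarrow> ('a list \<Rightarrow> 'a) \<Rightarrow> bool" where
  "left_commutative sc A m \<omega> \<longleftrightarrow>
     k_algebra sc A m \<omega> \<and> skew_symmetric_on sc A m \<omega> \<and>
     (\<forall>a. a ` {1..2*m-1} \<subseteq> A \<longrightarrow>
        (\<Sum>\<sigma> | \<sigma> permutes {1..2*m-2}.
           sc (of_int (sign \<sigma>))
             (\<omega> (map (\<lambda>i. a (\<sigma> i)) [1..<m] @
                 [\<omega> (map (\<lambda>i. a (\<sigma> i)) [m..<2*m-1] @ [a (2*m-1)])]))) = 0)"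

definition homotopical_lie ::
    "(complex \<Rightarrow> 'a::ab_group_add \<Rightarrow> 'a) \<Rightarrow> 'a set \<Rightarrow> nat \<Rightarrow> ('a list \<Rightarrow> 'a) \<Rightarrow> bool" where
  "homotopical_lie sc A m \<omega> \<longleftrightarrow>
     k_algebra sc A m \<omega> \<and> skew_symmetric_on sc A m \<omega> \<and>
     (\<forall>a. a ` {1..2*m-1} \<subseteq> A \<longrightarrow>
        (\<Sum>\<sigma> | \<sigma> permutes {1..2*m-1}.
           sc (of_int (sign \<sigma>))
             (\<omega> (map (\<lambda>i. a (\<sigma> i)) [1..<m] @
                 [\<omega> (map (\<lambda>i. a (\<sigma> i)) [m..<2*m-1] @ [a (\<sigma> (2*m-1))])]))) = 0)"

end

theory Submission
  imports Defs "HOL-Analysis.Determinants"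
begin

text \<open>Let \<open>n\<close> be the number of variables and think of \<open>s_k\<close> as the \<open>k\<close>-th power of one generic odd vector
  field. Everything rests on a count of derivatives, made precise as follows.

  The first-order part of a product of vector fields is their left-normed product for \<open>\<circ>\<close>, so
  that \<open>s_rsym\<close> is always the first-order part of \<open>s_k\<close> (\<open>s_rsym_eq_first_order\<close>). What has to
  be shown is thus that certain operators, built multilinearly from the given fields, vanish: the part
  of \<open>s_k\<close> of order at least \<open>2\<close>, \<open>s_k\<close> itself, or the left commutativity sum. All of these
  operations are compatible with the bracket by \<open>\<partial>_j\<close>, the infinitesimal translation. A compatible
  operation vanishes as soon as its value on monomial fields \<open>x^\<alpha> \<partial>_i\<close>, applied to a monomial
  \<open>x^\<beta>\<close>, always has constant term \<open>0\<close>: every other Taylor coefficient is a constant term after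
  differentiation, and the derivative can be moved to the arguments
  (\<open>eq_0_if_const_terms_eq_0\<close>).

  On monomials the operations are homogeneous, with \<open>x^\<alpha> \<partial>_i\<close> of degree \<open>\<bar>\<alpha>\<bar> - 1\<close>, and skew-symmetric. A
  nonzero constant term hence requires pairwise distinct fields with degrees adding up to
  \<open>- \<bar>\<beta>\<bar>\<close>. Only \<open>n\<close> fields have degree \<open>-1\<close> and only \<open>n\<^sup>2\<close> have degree \<open>0\<close>, which
  bounds the number \<open>k\<close> of the fields by \<open>n\<^sup>2 + 2 n - \<bar>\<beta>\<bar>\<close> (\<open>sum_defect_le\<close>). Constants are
  annihilated anyway; with \<open>\<bar>\<beta>\<bar> \<ge> 1\<close> this kills \<open>s_k\<close> for \<open>k > N + 1\<close>,
  and with \<open>\<bar>\<beta>\<bar> \<ge> 2\<close> the higher-order part of \<open>s_k\<close> for \<open>k > N\<close>.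
  The left commutativity sum is skew-symmetric in \<open>2 N - 2 > n\<^sup>2 + 2 n\<close> fields, too many for \<open>n > 1\<close>.

  For \<open>k = N\<close> the count leaves one possibility: all \<open>\<partial>_i\<close>, all \<open>x_j \<partial>_i\<close>, \<open>n - 2\<close> quadratic fields,
  and \<open>\<bar>\<beta>\<bar> = 2\<close>. By polarization the quadratic fields are \<open>l_r\<^sup>2 v_r\<close> and the function is \<open>l_0\<^sup>2\<close>,
  with only \<open>n - 1\<close> linear forms, which have a common zero \<open>e \<noteq> 0\<close>. Bracketing with
  \<open>L = x_m \<partial>_e\<close>, where \<open>e_m = 1\<close>, multiplies the value by the trace of \<open>ad L\<close> on the list of
  fields. The trace is \<open>-1\<close> on the \<open>\<partial>_i\<close>, \<open>0\<close> on the \<open>x_j \<partial>_i\<close>, and \<open>\<le> 0\<close> on the rest, so it is not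
  \<open>0\<close>; but \<open>L\<close> kills \<open>l_0\<^sup>2\<close>, and no polynomial in its image has a constant term. Hence the value is \<open>0\<close>
  (\<open>const_term_s_std_eigen\<close>, \<open>const_term_s_std_borderline\<close>).

  The derivation properties hold because \<open>ad X\<close> is a derivation of the associative product and, for
  affine \<open>X\<close>, commutes with taking first-order parts (\<open>first_order_ad_affine\<close>).\<close>

section \<open>Coefficients and degrees of polynomials\<close>

abbreviation const_term :: "'n U \<Rightarrow> complex" where
  "const_term p \<equiv> Poly_Mapping.lookup p 0"

definition mdeg :: "('n::finite \<Rightarrow>\<^sub>0 nat) \<Rightarrow> nat" where
  "mdeg \<alpha> = (\<Sum>i\<in>UNIV. Poly_Mapping.lookup \<alpha> i)"

lemma mdeg_0 [simp]: "mdeg 0 = 0"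
  by (simp add: mdeg_def)

lemma mdeg_add: "mdeg (\<alpha> + \<beta>) = mdeg \<alpha> + mdeg \<beta>"
  by (simp add: mdeg_def lookup_add sum.distrib)

lemma mdeg_single [simp]: "mdeg (Poly_Mapping.single i k) = k"
  by (simp add: mdeg_def lookup_single when_def)

lemma mdeg_eq_0_iff [simp]: "mdeg \<alpha> = 0 \<longleftrightarrow> \<alpha> = 0"
  by (auto simp: mdeg_def intro: poly_mapping_eqI)

lemma mdeg_Suc_cases:
  assumes "mdeg \<alpha> = Suc d"
  obtains i \<beta> where "\<alpha> = \<beta> + Poly_Mapping.single i 1" "mdeg \<beta> = d"
proof -
  have "\<alpha> \<noteq> 0" using assms by auto
  then obtain i where i: "Poly_Mapping.lookup \<alpha> i \<noteq> 0"
    by (metis lookup_zero poly_mapping_eqI)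
  define \<beta> where "\<beta> = \<alpha> - Poly_Mapping.single i 1"
  have a: "\<alpha> = \<beta> + Poly_Mapping.single i 1"
    by (rule poly_mapping_eqI)
       (use i in \<open>auto simp: \<beta>_def lookup_add lookup_minus lookup_single when_def\<close>)
  have "mdeg \<alpha> = mdeg \<beta> + 1"
    by (subst a) (simp add: mdeg_add)
  with assms that[OF a] show ?thesis by simp
qed

lemma mdeg_1_cases:
  assumes "mdeg \<alpha> = 1"
  obtains i where "\<alpha> = Poly_Mapping.single i 1"
  using assms by (metis One_nat_def add_0 mdeg_Suc_cases mdeg_eq_0_iff)

lemma lookup_const_mult [simp]:
  "Poly_Mapping.lookup (const c * p) m = c * Poly_Mapping.lookup p m"
  by (simp add: const_def map.rep_eq when_def flip: mult_map_scale_conv_mult)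

lemma const_add: "const (a + b) = const a + const b"
  by (simp add: const_def single_add)

lemma const_mult: "const (a * b) = const a * const b"
  by (simp add: const_def mult_single)

lemma const_0 [simp]: "const 0 = 0"
  by (simp add: const_def)

lemma const_1 [simp]: "const 1 = 1"
  by (simp add: const_def)

lemma const_uminus: "const (- a) = - const a"
  by (simp add: const_def single_uminus)

lemma pd_const [simp]: "pd i (const c) = 0"
  by (simp add: const_def pd_single)

lemma pd_1 [simp]: "pd i 1 = 0"
  using pd_const[of i 1] by simp

text \<open>Differentiation shifts coefficients, so that every coefficient of \<open>p\<close>
  can be reached as the constant term of a derivative, up to a nonzero factor.\<close>

lemma lookup_pd:
  "Poly_Mapping.lookup (pd i p) m
     = of_nat (Suc (Poly_Mapping.lookup m i)) * Poly_Mapping.lookup p (m + Poly_Mapping.single i 1)"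
proof -
  let ?e = "Poly_Mapping.single i (1::nat)"
  have *: "Poly_Mapping.lookup (pd i (Poly_Mapping.single k c)) m
      = of_nat (Suc (Poly_Mapping.lookup m i)) * Poly_Mapping.lookup (Poly_Mapping.single k c) (m + ?e)"
    for k and c :: complex
  proof (cases "k = m + ?e")
    case True
    then show ?thesis by (simp add: pd_single lookup_add)
  next
    case False
    have "k = m + ?e" if "k - ?e = m" "Poly_Mapping.lookup k i \<noteq> 0"
      by (rule poly_mapping_eqI)
         (use that in \<open>auto simp: lookup_add lookup_minus lookup_single when_def\<close>)
    with False show ?thesis
      by (cases "Poly_Mapping.lookup k i = 0") (auto simp: pd_single lookup_single when_def)
  qed
  have p: "p = (\<Sum>m\<in>Poly_Mapping.keys p. Poly_Mapping.single m (Poly_Mapping.lookup p m))"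
    by (rule sum_single)
  show ?thesis
    by (subst (1 2) p) (simp add: pd_sum lookup_sum * sum_distrib_left del: of_nat_Suc)
qed

lemma const_if_pd_eq_0:
  fixes p :: "'n::finite U"
  assumes "\<And>i. pd i p = 0"
  shows "p = const (const_term p)"
proof (rule poly_mapping_eqI)
  fix m
  show "Poly_Mapping.lookup p m = Poly_Mapping.lookup (const (const_term p)) m"
  proof (cases "mdeg m")
    case 0
    then show ?thesis by (simp add: const_def)
  next
    case (Suc d)
    then obtain i k where m: "m = k + Poly_Mapping.single i 1" using mdeg_Suc_cases by blast
    have "Poly_Mapping.lookup p m = 0"
      using lookup_pd[of i p k] assms[of i] by (simp add: m del: of_nat_Suc)
    moreover have "m \<noteq> 0" using Suc by auto
    ultimately show ?thesis by (simp add: const_def lookup_single when_def)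
  qed
qed

lemma const_term_mult: "const_term (p * q) = const_term p * const_term (q :: 'n U)"
proof -
  let ?q = "q - const (const_term q)"
  have "0 \<notin> Poly_Mapping.keys (p * ?q)"
  proof
    assume "0 \<in> Poly_Mapping.keys (p * ?q)"
    then obtain a b where ab: "0 = a + b" "b \<in> Poly_Mapping.keys ?q"
      using keys_mult[of p ?q] by blast
    have "b = 0"
    proof (rule poly_mapping_eqI)
      fix k
      have "Poly_Mapping.lookup (a + b) k = 0" by (simp flip: ab(1))
      then show "Poly_Mapping.lookup b k = Poly_Mapping.lookup 0 k" by (simp add: lookup_add)
    qed
    with ab(2) show False by (simp add: in_keys_iff lookup_minus const_def)
  qed
  then have "const_term (p * ?q) = 0" by (simp add: in_keys_iff)
  moreover have "p * ?q = p * q - const (const_term q) * p"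
    by (simp add: right_diff_distrib mult.commute)
  ultimately show ?thesis by (simp add: lookup_minus)
qed

text \<open>The zero polynomial has every degree, and degrees may be negative, so that degrees simply
  add up when operators are applied.\<close>

definition homogeneous :: "int \<Rightarrow> 'n::finite U \<Rightarrow> bool" where
  "homogeneous d p \<longleftrightarrow> (\<forall>m\<in>Poly_Mapping.keys p. int (mdeg m) = d)"

lemma homogeneous_0 [simp]: "homogeneous d 0"
  by (simp add: homogeneous_def)

lemma homogeneous_add: "homogeneous d p \<Longrightarrow> homogeneous d q \<Longrightarrow> homogeneous d (p + q)"
  using keys_add[of p q] by (auto simp: homogeneous_def)

lemma homogeneous_sum: "(\<And>a. a \<in> A \<Longrightarrow> homogeneous d (f a)) \<Longrightarrow> homogeneous d (sum f A)"
  by (induction A rule: infinite_finite_induct) (auto intro: homogeneous_add)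

lemma homogeneous_mult: "homogeneous d p \<Longrightarrow> homogeneous e q \<Longrightarrow> homogeneous (d + e) (p * q)"
  using keys_mult[of p q] by (force simp: homogeneous_def mdeg_add)

lemma homogeneous_single: "homogeneous (int (mdeg \<alpha>)) (Poly_Mapping.single \<alpha> c)"
  by (auto simp: homogeneous_def)

lemma homogeneous_const: "homogeneous 0 (const c)"
  using homogeneous_single[of 0 c] by (simp add: const_def)

text \<open>The value \<open>d = 0\<close> is covered as well: the derivative of a constant is
  \<open>0\<close>, which has degree \<open>-1\<close>.\<close>

lemma homogeneous_pd:
  assumes "homogeneous d p"
  shows "homogeneous (d - 1) (pd i p)"
  unfolding homogeneous_def
proof
  fix m assume "m \<in> Poly_Mapping.keys (pd i p)"
  then have "m + Poly_Mapping.single i 1 \<in> Poly_Mapping.keys p"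
    by (auto simp: in_keys_iff lookup_pd)
  with assms have "int (mdeg (m + Poly_Mapping.single i 1)) = d" by (auto simp: homogeneous_def)
  then show "int (mdeg m) = d - 1" by (simp add: mdeg_add)
qed

lemma const_term_homogeneous: "homogeneous d p \<Longrightarrow> d \<noteq> 0 \<Longrightarrow> const_term p = 0"
  by (auto simp: homogeneous_def in_keys_iff)

lemma monomial_induct:
  assumes "\<And>p q. P p \<Longrightarrow> P q \<Longrightarrow> P (p + q)" "\<And>c p. P p \<Longrightarrow> P (const c * p)"
    and "\<And>\<beta>. P (Poly_Mapping.single \<beta> 1)"
  shows "P p"
proof -
  have 0: "P 0" using assms(2)[OF assms(3), of 0] by simp
  have 1: "P (Poly_Mapping.single \<beta> c)" for \<beta> c
    using assms(2)[OF assms(3), of c \<beta>] by (simp add: const_def mult_single)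
  have "P (\<Sum>m\<in>A. Poly_Mapping.single m (f m))" for A f
    by (induction A rule: infinite_finite_induct) (auto intro: 0 1 assms(1))
  then show ?thesis by (subst sum_single)
qed

section \<open>Differential operators\<close>

lemma Diff_eqI: "(\<And>f. Diff_apply X f = Diff_apply Y f) \<Longrightarrow> X = Y"
  by (simp add: Diff_apply_inject[symmetric] fun_eq_iff)

lemma Diff_apply_0 [simp]: "Diff_apply 0 f = 0"
  by (simp add: zero_Diff.rep_eq)

lemma Diff_apply_1 [simp]: "Diff_apply 1 f = f"
  by (simp add: one_Diff.rep_eq)

lemma Diff_apply_add [simp]: "Diff_apply (X + Y) f = Diff_apply X f + Diff_apply Y f"
  by (simp add: plus_Diff.rep_eq)

lemma Diff_apply_diff [simp]: "Diff_apply (X - Y) f = Diff_apply X f - Diff_apply Y f"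
  by (simp add: minus_Diff.rep_eq)

lemma Diff_apply_mult [simp]: "Diff_apply (X * Y) f = Diff_apply Y (Diff_apply X f)"
  by (simp add: times_Diff.rep_eq)

lemma Diff_apply_scaleD [simp]: "Diff_apply (scaleD c X) f = const c * Diff_apply X f"
  by (simp add: scaleD.rep_eq)

lemma Diff_apply_sum [simp]: "Diff_apply (sum F A) f = (\<Sum>a\<in>A. Diff_apply (F a) f)"
  by (induction A rule: infinite_finite_induct) simp_all

lemma Diff_apply_vf: "Diff_apply (vf u) f = (\<Sum>i\<in>UNIV. u i * pd i f)"
  by (simp add: vf.rep_eq)

lemma Diff_apply_arg_add [simp]: "Diff_apply X (f + g) = Diff_apply X f + Diff_apply X g"
  by (rule Diff_set_linear[OF Diff_apply])

lemma Diff_apply_arg_const [simp]: "Diff_apply X (const c * f) = const c * Diff_apply X f"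
  by (rule Diff_set_linear[OF Diff_apply])

lemma Diff_apply_arg_0 [simp]: "Diff_apply X 0 = 0"
  using Diff_apply_arg_add[of X 0 0] by simp

lemma Diff_apply_arg_diff [simp]: "Diff_apply X (f - g) = Diff_apply X f - Diff_apply X g"
  using Diff_apply_arg_add[of X "f - g" g] by (simp add: algebra_simps)

lemma Diff_apply_arg_sum [simp]: "Diff_apply X (sum f A) = (\<Sum>a\<in>A. Diff_apply X (f a))"
  by (induction A rule: infinite_finite_induct) simp_all

lemma scaleD_mult_left: "scaleD c X * Y = scaleD c (X * Y)"
  by (rule Diff_eqI) simp

lemma scaleD_mult_right: "X * scaleD c Y = scaleD c (X * Y)"
  by (rule Diff_eqI) simp

lemma Diff_apply_of_int: "Diff_apply (of_int z) f = const (of_int z) * f"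
proof -
  have nat: "Diff_apply (of_nat n) f = const (of_nat n) * f" for n
    by (induction n) (simp_all add: const_add distrib_right)
  show ?thesis
  proof (cases z rule: int_diff_cases)
    case (diff m n)
    then show ?thesis by (simp add: nat const_def single_diff left_diff_distrib)
  qed
qed

lemma of_int_mult_eq_scaleD: "of_int z * X = scaleD (of_int z) X"
  by (rule Diff_eqI) (simp add: Diff_apply_of_int)

lemma Diff_eq_neg_self_imp_0: "X = - X \<Longrightarrow> X = (0 :: 'n::finite Diff)"
  using Diff.scale_left_distrib[of 1 1 X] by (metis Diff.scale_eq_0_iff Diff.scale_one
      add.right_inverse one_add_one zero_neq_numeral)

abbreviation linear_op :: "('n::finite Diff \<Rightarrow> 'n Diff) \<Rightarrow> bool" where
  "linear_op \<equiv> Vector_Spaces.linear scaleD scaleD"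

interpretation Diff_pair: vector_space_pair "scaleD :: complex \<Rightarrow> 'n::finite Diff \<Rightarrow> 'n Diff" scaleD
  by unfold_locales

lemma linear_opI:
  "(\<And>x y. F (x + y) = F x + F y) \<Longrightarrow> (\<And>c x. F (scaleD c x) = scaleD c (F x)) \<Longrightarrow> linear_op F"
  unfolding Vector_Spaces.linear_iff using Diff.vector_space_axioms by blast

lemma linear_op_add: "linear_op F \<Longrightarrow> F (x + y) = F x + F y"
  by (simp add: Vector_Spaces.linear_iff)

lemma linear_op_scale: "linear_op F \<Longrightarrow> F (scaleD c x) = scaleD c (F x)"
  by (simp add: Vector_Spaces.linear_iff)

lemma ad_alt: "ad X Y = Y * X - X * Y"
  by (simp add: ad_def comm_def)

lemma linear_op_ad: "linear_op (ad X)"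
  by (rule linear_opI)
     (simp_all add: ad_alt algebra_simps scaleD_mult_left scaleD_mult_right Diff.scale_right_diff_distrib)

lemma ad_mult: "ad X (Y * Z) = ad X Y * Z + Y * ad X Z"
  by (simp add: ad_alt algebra_simps)

section \<open>Vector fields and the first-order part\<close>

lemma vf_add: "vf u + vf v = vf (\<lambda>i. u i + v i)"
  by (rule Diff_eqI) (simp add: Diff_apply_vf distrib_right sum.distrib)

lemma vf_scale: "scaleD c (vf u) = vf (\<lambda>i. const c * u i)"
  by (rule Diff_eqI) (simp add: Diff_apply_vf sum_distrib_left mult.assoc)

lemma vf_0: "vf (\<lambda>i. 0) = 0"
  by (rule Diff_eqI) (simp add: Diff_apply_vf)

lemma vf_sum: "(\<Sum>a\<in>A. vf (u a)) = vf (\<lambda>i. \<Sum>a\<in>A. u a i)"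
  by (induction A rule: infinite_finite_induct) (simp_all add: vf_0 vf_add)

lemma vf_in_Vect [simp]: "vf u \<in> Vect"
  by (simp add: Vect_def)

lemma subspace_Vect: "Diff.subspace Vect"
  by (rule Diff.subspaceI) (auto simp: Vect_def vf_add vf_scale intro: range_eqI[of _ _ "\<lambda>_. 0"] simp flip: vf_0)

lemma Diff_apply_var [simp]: "Diff_apply (vf u) (var i) = u i"
  using fun_cong[OF vcoeff_vf[of u], of i] by (simp only: vcoeff_def)

lemma vf_eq_iff: "vf u = vf v \<longleftrightarrow> u = v"
  by (metis vcoeff_vf)

lemma ad_vf:
  "ad (vf v) (vf u) = vf (\<lambda>i. (\<Sum>j\<in>UNIV. v j * pd j (u i)) - (\<Sum>j\<in>UNIV. u j * pd j (v i)))"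
proof (rule Diff_eqI)
  fix f
  have "Diff_apply (vf u * vf v) f
      = (\<Sum>i\<in>UNIV. \<Sum>j\<in>UNIV. v j * pd j (u i) * pd i f) + (\<Sum>i\<in>UNIV. \<Sum>j\<in>UNIV. u i * v j * pd i (pd j f))"
    for u v :: "'a \<Rightarrow> 'a U"
    by (simp add: Diff_apply_vf pd_sum pd_mult sum_distrib_left distrib_left sum.distrib mult_ac
          pd_commute)
  note this[of u v] this[of v u]
  moreover have "(\<Sum>i\<in>UNIV. \<Sum>j\<in>UNIV. v i * u j * pd i (pd j f))
      = (\<Sum>i\<in>UNIV. \<Sum>j\<in>UNIV. u i * v j * pd i (pd j f))"
    by (subst sum.swap) (simp add: mult_ac pd_commute)
  ultimately have "Diff_apply (ad (vf v) (vf u)) f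
      = (\<Sum>i\<in>UNIV. \<Sum>j\<in>UNIV. v j * pd j (u i) * pd i f) - (\<Sum>i\<in>UNIV. \<Sum>j\<in>UNIV. u j * pd j (v i) * pd i f)"
    by (simp only: ad_alt Diff_apply_diff) simp
  then show "Diff_apply (ad (vf v) (vf u)) f
      = Diff_apply (vf (\<lambda>i. (\<Sum>j\<in>UNIV. v j * pd j (u i)) - (\<Sum>j\<in>UNIV. u j * pd j (v i)))) f"
    by (simp add: Diff_apply_vf left_diff_distrib sum_subtractf sum_distrib_right)
qed

lemma ad_in_Vect: "X \<in> Vect \<Longrightarrow> Y \<in> Vect \<Longrightarrow> ad X Y \<in> Vect"
  by (auto simp: Vect_def ad_vf)

text \<open>The terms of order \<open>1\<close> of an operator without constant term: the
  \<open>i\<close>-th coefficient is the value at the variable \<open>x_i\<close>.\<close>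

definition first_order :: "'n::finite Diff \<Rightarrow> 'n Diff" where
  "first_order D = vf (vcoeff D)"

lemma first_order_in_Vect [simp]: "first_order D \<in> Vect"
  by (simp add: first_order_def)

lemma first_order_Vect: "X \<in> Vect \<Longrightarrow> first_order X = X"
  by (auto simp: Vect_def first_order_def)

lemma linear_op_first_order: "linear_op first_order"
  by (rule linear_opI) (simp_all add: first_order_def vcoeff_def[abs_def] vf_add vf_scale)

text \<open>The terms of order at least \<open>2\<close> of \<open>D\<close> remain of order at
  least \<open>2\<close> after multiplication by \<open>Y\<close> from the right, so they do not
  affect first-order parts.\<close>

lemma rsym_first_order: "Y \<in> Vect \<Longrightarrow> rsym (first_order D) Y = first_order (D * Y)"
  by (auto simp: Vect_def rsym_def first_order_def vf_eq_iff fun_eq_iff)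
     (simp add: vcoeff_def Diff_apply_vf)

text \<open>The empty list is excluded, since the first-order part of the empty product, the
  identity, is the Euler field and not \<open>0\<close>.\<close>

lemma left_normed_rsym:
  assumes "Xs \<noteq> []" "set Xs \<subseteq> Vect"
  shows "left_normed rsym Xs = first_order (prod_list Xs)"
proof -
  have "foldl rsym (first_order D) Ys = first_order (D * prod_list Ys)" if "set Ys \<subseteq> Vect"
    for D and Ys :: "'a Diff list"
    using that by (induction Ys arbitrary: D) (simp_all add: rsym_first_order mult.assoc)
  with assms show ?thesis
    by (cases Xs) (simp_all, metis first_order_Vect)
qed

lemma permute_list_eq_Nil_iff [simp]: "permute_list \<sigma> xs = [] \<longleftrightarrow> xs = []"
  by (simp add: permute_list_def)

lemma s_rsym_eq_first_order:
  assumes "Xs \<noteq> []" "set Xs \<subseteq> Vect"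
  shows "s_rsym Xs = first_order (s_std Xs)"
proof -
  have "left_normed rsym (permute_list \<sigma> Xs) = first_order (prod_list (permute_list \<sigma> Xs))"
    if "\<sigma> permutes {..<length Xs}" for \<sigma>
    by (rule left_normed_rsym) (use assms that in simp_all)
  then show ?thesis
    by (simp add: s_rsym_def s_std_def of_int_mult_eq_scaleD
          Diff_pair.linear_sum[OF linear_op_first_order] linear_op_scale[OF linear_op_first_order])
qed

text \<open>On operators without constant term, taking the first-order part commutes with the brackets by
  affine fields, because these preserve the space of polynomials of degree at most \<open>1\<close>, on which an
  operator acts through its first-order part.\<close>

lemma first_order_ad_affine:
  assumes u: "\<And>i j l. pd i (pd j (u l)) = 0" and D: "Diff_apply D 1 = 0"
  shows "first_order (ad (vf u) D) = ad (vf u) (first_order D)"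
proof -
  have "Diff_apply D (u i) = (\<Sum>j\<in>UNIV. Diff_apply D (var j) * pd j (u i))" for i
  proof -
    define a where "a j = const_term (pd j (u i))" for j
    have a: "pd j (u i) = const (a j)" for j
      unfolding a_def by (rule const_if_pd_eq_0) (rule u)
    define w where "w = u i - (\<Sum>j\<in>UNIV. const (a j) * var j)"
    have "pd k (\<Sum>j\<in>UNIV. const (a j) * var j) = const (a k)" for k
      by (simp add: pd_sum pd_const_mult pd_var if_distrib cong: if_cong)
    then have "pd k w = 0" for k
      using pd_add[of k w "\<Sum>j\<in>UNIV. const (a j) * var j"] by (simp add: w_def a)
    then obtain c where "w = const c * 1" using const_if_pd_eq_0[of w] by auto
    then have "Diff_apply D w = 0" by (simp only: Diff_apply_arg_const D) simp
    then have "Diff_apply D (u i) = (\<Sum>j\<in>UNIV. const (a j) * Diff_apply D (var j))"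
      by (simp add: w_def)
    then show ?thesis by (simp add: a mult.commute)
  qed
  moreover have "vcoeff (ad (vf u) D) i
      = (\<Sum>j\<in>UNIV. u j * pd j (vcoeff D i)) - Diff_apply D (u i)" for i
    by (simp add: vcoeff_def ad_alt) (simp add: Diff_apply_vf)
  ultimately show ?thesis
    unfolding first_order_def ad_vf by (simp add: vf_eq_iff fun_eq_iff vcoeff_def)
qed

section \<open>Multilinear operations compatible with brackets\<close>

text \<open>An operation with arguments \<open>a p\<close>, \<open>p \<in> S\<close>, that is a derivation for all brackets. Arguments
  are families rather than lists because operations are to be substituted into each other.\<close>

definition equivariant :: "nat set \<Rightarrow> ((nat \<Rightarrow> 'n::finite Diff) \<Rightarrow> 'n Diff) \<Rightarrow> bool" where
  "equivariant S \<Phi> \<longleftrightarrow>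
     (\<forall>a b. (\<forall>p\<in>S. a p = b p) \<longrightarrow> \<Phi> a = \<Phi> b) \<and>
     (\<forall>a. \<forall>p\<in>S. linear_op (\<lambda>x. \<Phi> (a(p := x)))) \<and>
     (\<forall>X a. ad X (\<Phi> a) = (\<Sum>p\<in>S. \<Phi> (a(p := ad X (a p)))))"

lemma equivariantI:
  assumes "\<And>a b. (\<And>p. p \<in> S \<Longrightarrow> a p = b p) \<Longrightarrow> \<Phi> a = \<Phi> b"
    and "\<And>a p. p \<in> S \<Longrightarrow> linear_op (\<lambda>x. \<Phi> (a(p := x)))"
    and "\<And>X a. ad X (\<Phi> a) = (\<Sum>p\<in>S. \<Phi> (a(p := ad X (a p))))"
  shows "equivariant S \<Phi>"
  using assms unfolding equivariant_def by blast

lemma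
  assumes "equivariant S \<Phi>"
  shows equivariant_cong: "(\<And>p. p \<in> S \<Longrightarrow> a p = b p) \<Longrightarrow> \<Phi> a = \<Phi> b"
    and equivariant_linear: "p \<in> S \<Longrightarrow> linear_op (\<lambda>x. \<Phi> (a(p := x)))"
    and equivariant_ad: "ad X (\<Phi> a) = (\<Sum>p\<in>S. \<Phi> (a(p := ad X (a p))))"
  using assms unfolding equivariant_def by blast+

lemma equivariant_one: "equivariant {} (\<lambda>a. 1)"
  by (rule equivariantI) (simp_all add: ad_alt)

lemma equivariant_arg: "equivariant {p} (\<lambda>a. a p)"
  by (rule equivariantI) (simp_all add: linear_opI)

lemma equivariant_mult:
  assumes \<Phi>: "equivariant S \<Phi>" and \<Psi>: "equivariant T \<Psi>" and "S \<inter> T = {}" "finite S" "finite T"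
  shows "equivariant (S \<union> T) (\<lambda>a. \<Phi> a * \<Psi> a)"
proof -
  have S: "\<Psi> (a(p := x)) = \<Psi> a" if "p \<in> S" for a p x
    by (rule equivariant_cong[OF \<Psi>]) (use that assms(3) in auto)
  have T: "\<Phi> (a(p := x)) = \<Phi> a" if "p \<in> T" for a p x
    by (rule equivariant_cong[OF \<Phi>]) (use that assms(3) in auto)
  show ?thesis
  proof (rule equivariantI)
    fix a b :: "nat \<Rightarrow> 'a Diff" assume "\<And>p. p \<in> S \<union> T \<Longrightarrow> a p = b p"
    then have "\<Phi> a = \<Phi> b" "\<Psi> a = \<Psi> b"
      by (auto intro: equivariant_cong[OF \<Phi>] equivariant_cong[OF \<Psi>])
    then show "\<Phi> a * \<Psi> a = \<Phi> b * \<Psi> b" by simp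
  next
    fix a p assume p: "p \<in> S \<union> T"
    show "linear_op (\<lambda>x. \<Phi> (a(p := x)) * \<Psi> (a(p := x)))"
    proof (cases "p \<in> S")
      case True
      note lin = equivariant_linear[OF \<Phi> True]
      show ?thesis
        by (rule linear_opI)
           (simp_all add: S[OF True] linear_op_add[OF lin] linear_op_scale[OF lin] distrib_right
              scaleD_mult_left)
    next
      case False
      with p have p: "p \<in> T" by blast
      note lin = equivariant_linear[OF \<Psi> p]
      show ?thesis
        by (rule linear_opI)
           (simp_all add: T[OF p] linear_op_add[OF lin] linear_op_scale[OF lin] distrib_left
              scaleD_mult_right)
    qed
  next
    fix X a
    show "ad X (\<Phi> a * \<Psi> a)
        = (\<Sum>p\<in>S \<union> T. \<Phi> (a(p := ad X (a p))) * \<Psi> (a(p := ad X (a p))))"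
      using assms(3-5)
      by (simp add: ad_mult equivariant_ad[OF \<Phi>] equivariant_ad[OF \<Psi>] sum.union_disjoint S T
            sum_distrib_left sum_distrib_right)
  qed
qed

lemma equivariant_prod_list:
  "distinct ps \<Longrightarrow> equivariant (set ps) (\<lambda>a. prod_list (map a ps))"
proof (induction ps)
  case Nil
  then show ?case by (simp add: equivariant_one)
next
  case (Cons p ps)
  then show ?case using equivariant_mult[OF equivariant_arg[of p], of "set ps"] by simp
qed

lemma equivariant_reindex:
  assumes \<Phi>: "equivariant S \<Phi>" and h: "inj_on h S"
  shows "equivariant (h ` S) (\<lambda>a. \<Phi> (a \<circ> h))"
proof -
  have upd: "\<Phi> (a(h p := x) \<circ> h) = \<Phi> ((a \<circ> h)(p := x))" if "p \<in> S" for a p x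
    by (rule equivariant_cong[OF \<Phi>]) (use that h in \<open>auto simp: inj_on_def\<close>)
  show ?thesis
  proof (rule equivariantI)
    fix a b :: "nat \<Rightarrow> 'a Diff" assume "\<And>p. p \<in> h ` S \<Longrightarrow> a p = b p"
    then show "\<Phi> (a \<circ> h) = \<Phi> (b \<circ> h)" by (intro equivariant_cong[OF \<Phi>]) auto
  next
    fix a p assume "p \<in> h ` S"
    then show "linear_op (\<lambda>x. \<Phi> (a(p := x) \<circ> h))"
      by (auto simp: upd intro: equivariant_linear[OF \<Phi>])
  next
    fix X a
    show "ad X (\<Phi> (a \<circ> h)) = (\<Sum>p\<in>h ` S. \<Phi> (a(p := ad X (a p)) \<circ> h))"
      by (simp add: sum.reindex[OF h] equivariant_ad[OF \<Phi>] upd)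
  qed
qed

text \<open>Substituting an operation into the argument \<open>z\<close> of another one. The
  index \<open>z\<close> may lie in \<open>T\<close>, since the outer operation sees only the
  substituted value there.\<close>

lemma equivariant_subst:
  assumes \<Phi>: "equivariant (insert z S) \<Phi>" and \<Psi>: "equivariant T \<Psi>"
    and "z \<notin> S" "S \<inter> T = {}" "finite S" "finite T"
  shows "equivariant (S \<union> T) (\<lambda>a. \<Phi> (a(z := \<Psi> a)))"
proof -
  have S: "\<Phi> ((a(p := x))(z := \<Psi> (a(p := x)))) = \<Phi> ((a(z := \<Psi> a))(p := x))" if "p \<in> S" for a p x
  proof -
    have "\<Psi> (a(p := x)) = \<Psi> a"
      by (rule equivariant_cong[OF \<Psi>]) (use that assms(4) in auto)
    moreover have "z \<noteq> p" using that assms(3) by auto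
    ultimately show ?thesis by (simp add: fun_upd_twist)
  qed
  have T: "\<Phi> ((a(p := x))(z := w)) = \<Phi> (a(z := w))" if "p \<in> T" for a p x w
    by (rule equivariant_cong[OF \<Phi>]) (use that assms(4) in auto)
  have lin: "linear_op (\<lambda>x. \<Phi> (a(z := x)))" for a
    by (rule equivariant_linear[OF \<Phi>]) simp
  show ?thesis
  proof (rule equivariantI)
    fix a b :: "nat \<Rightarrow> 'a Diff" assume ab: "\<And>p. p \<in> S \<union> T \<Longrightarrow> a p = b p"
    then have "\<Psi> a = \<Psi> b" by (auto intro: equivariant_cong[OF \<Psi>])
    with ab show "\<Phi> (a(z := \<Psi> a)) = \<Phi> (b(z := \<Psi> b))"
      by (intro equivariant_cong[OF \<Phi>]) auto
  next
    fix a p assume p: "p \<in> S \<union> T"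
    show "linear_op (\<lambda>x. \<Phi> ((a(p := x))(z := \<Psi> (a(p := x)))))"
    proof (cases "p \<in> S")
      case True
      then show ?thesis by (simp add: S equivariant_linear[OF \<Phi>])
    next
      case False
      with p have p: "p \<in> T" by blast
      note lin' = equivariant_linear[OF \<Psi> p]
      show ?thesis
        by (rule linear_opI)
           (simp_all add: T[OF p] linear_op_add[OF lin'] linear_op_scale[OF lin']
              linear_op_add[OF lin] linear_op_scale[OF lin])
    qed
  next
    fix X a
    have 1: "ad X (\<Phi> (a(z := \<Psi> a)))
        = \<Phi> (a(z := ad X (\<Psi> a))) + (\<Sum>p\<in>S. \<Phi> ((a(z := \<Psi> a))(p := ad X (a p))))"
      using assms(3,5) by (auto simp: equivariant_ad[OF \<Phi>] intro!: sum.cong)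
    have 2: "\<Phi> (a(z := ad X (\<Psi> a))) = (\<Sum>p\<in>T. \<Phi> (a(z := \<Psi> (a(p := ad X (a p))))))"
      by (simp add: equivariant_ad[OF \<Psi>] Diff_pair.linear_sum[OF lin])
    show "ad X (\<Phi> (a(z := \<Psi> a)))
        = (\<Sum>p\<in>S \<union> T. \<Phi> ((a(p := ad X (a p)))(z := \<Psi> (a(p := ad X (a p))))))"
      using assms(4-6) by (simp only: 1 2 sum.union_disjoint) (simp add: S T add.commute)
  qed
qed

section \<open>Skew-symmetrisation\<close>

definition skew_sum ::
    "nat set \<Rightarrow> ((nat \<Rightarrow> 'n::finite Diff) \<Rightarrow> 'n Diff) \<Rightarrow> (nat \<Rightarrow> 'n Diff) \<Rightarrow> 'n Diff" where
  "skew_sum S \<Phi> a = (\<Sum>\<sigma> | \<sigma> permutes S. of_int (sign \<sigma>) * \<Phi> (a \<circ> \<sigma>))"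

lemma skew_sum_permute:
  assumes "finite S" "\<tau> permutes S"
  shows "skew_sum S \<Phi> (a \<circ> \<tau>) = of_int (sign \<tau>) * skew_sum S \<Phi> a"
proof -
  have perm: "permutation \<tau>" using assms by (auto simp: permutation_permutes)
  have "skew_sum S \<Phi> a = (\<Sum>\<sigma> | \<sigma> permutes S. of_int (sign (\<tau> \<circ> \<sigma>)) * \<Phi> (a \<circ> (\<tau> \<circ> \<sigma>)))"
    unfolding skew_sum_def by (rule setum_permutations_compose_left[OF assms(2)])
  also have "\<dots> = of_int (sign \<tau>) * skew_sum S \<Phi> (a \<circ> \<tau>)"
    unfolding skew_sum_def sum_distrib_left
  proof (rule sum.cong)
    fix \<sigma> assume "\<sigma> \<in> {\<sigma>. \<sigma> permutes S}"
    then have "permutation \<sigma>" using assms by (auto simp: permutation_permutes)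
    then show "of_int (sign (\<tau> \<circ> \<sigma>)) * \<Phi> (a \<circ> (\<tau> \<circ> \<sigma>))
        = of_int (sign \<tau>) * (of_int (sign \<sigma>) * \<Phi> (a \<circ> \<tau> \<circ> \<sigma>))"
      by (simp add: sign_compose perm mult.assoc comp_assoc)
  qed simp
  finally show ?thesis by (simp add: sign_def)
qed

lemma skew_sum_eq_0:
  assumes "finite S" "i \<in> S" "j \<in> S" "i \<noteq> j" "a i = a j"
  shows "skew_sum S \<Phi> a = 0"
proof -
  have "a \<circ> Transposition.transpose i j = a"
    using assms(5) by (auto simp: fun_eq_iff Transposition.transpose_def)
  with skew_sum_permute[OF assms(1) permutes_swap_id[OF assms(2,3)], of \<Phi> a] assms(4)
  have "skew_sum S \<Phi> a = - skew_sum S \<Phi> a" by (simp add: sign_swap_id)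
  then show ?thesis by (rule Diff_eq_neg_self_imp_0)
qed

text \<open>The arguments outside \<open>S\<close> stay in place, as needed for the last
  argument in left commutativity.\<close>

lemma equivariant_skew_sum:
  assumes \<Phi>: "equivariant U \<Phi>" and "S \<subseteq> U" "finite U"
  shows "equivariant U (skew_sum S \<Phi>)"
proof -
  have U: "\<sigma> permutes U" if "\<sigma> permutes S" for \<sigma> using that assms(2) by (rule permutes_subset)
  have upd: "a(\<sigma> p := x) \<circ> \<sigma> = (a \<circ> \<sigma>)(p := x)" if "\<sigma> permutes S" for a :: "nat \<Rightarrow> 'a Diff" and \<sigma> p x
    using permutes_inj[OF that] by (auto simp: fun_eq_iff inj_def)
  show ?thesis
  proof (rule equivariantI)
    fix a b :: "nat \<Rightarrow> 'a Diff" assume ab: "\<And>p. p \<in> U \<Longrightarrow> a p = b p"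
    have "\<Phi> (a \<circ> \<sigma>) = \<Phi> (b \<circ> \<sigma>)" if "\<sigma> permutes S" for \<sigma>
      by (rule equivariant_cong[OF \<Phi>]) (simp add: ab permutes_in_image[OF U[OF that]])
    then show "skew_sum S \<Phi> a = skew_sum S \<Phi> b" by (simp add: skew_sum_def)
  next
    fix a p assume p: "p \<in> U"
    have lin: "linear_op (\<lambda>x. \<Phi> (a(p := x) \<circ> \<sigma>))" if \<sigma>: "\<sigma> permutes S" for \<sigma>
    proof -
      obtain q where q: "p = \<sigma> q" using permutes_surj[OF \<sigma>] by blast
      with p have "q \<in> U" using permutes_in_image[OF U[OF \<sigma>]] by blast
      then show ?thesis unfolding q upd[OF \<sigma>] by (rule equivariant_linear[OF \<Phi>])
    qed
    show "linear_op (\<lambda>x. skew_sum S \<Phi> (a(p := x)))"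
      unfolding skew_sum_def of_int_mult_eq_scaleD
      by (intro Diff_pair.linear_compose_sum Diff_pair.linear_compose_scale_right ballI) (simp add: lin)
  next
    fix X a
    have "ad X (\<Phi> (a \<circ> \<sigma>)) = (\<Sum>p\<in>U. \<Phi> (a(p := ad X (a p)) \<circ> \<sigma>))" if \<sigma>: "\<sigma> permutes S" for \<sigma>
    proof -
      have "ad X (\<Phi> (a \<circ> \<sigma>)) = (\<Sum>p\<in>U. \<Phi> (a(\<sigma> p := ad X (a (\<sigma> p))) \<circ> \<sigma>))"
        by (simp add: equivariant_ad[OF \<Phi>] upd[OF \<sigma>])
      also have "\<dots> = (\<Sum>p\<in>U. \<Phi> (a(p := ad X (a p)) \<circ> \<sigma>))"
        using sum.permute[OF U[OF \<sigma>], of "\<lambda>p. \<Phi> (a(p := ad X (a p)) \<circ> \<sigma>)"] by (simp add: comp_def)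
      finally show ?thesis .
    qed
    then show "ad X (skew_sum S \<Phi> a) = (\<Sum>p\<in>U. skew_sum S \<Phi> (a(p := ad X (a p))))"
      unfolding skew_sum_def of_int_mult_eq_scaleD
      by (subst sum.swap)
         (simp add: Diff_pair.linear_sum[OF linear_op_ad] linear_op_scale[OF linear_op_ad]
            Diff.scale_sum_right)
  qed
qed

section \<open>The standard polynomials\<close>

lemma s_std_eq_skew_sum:
  "s_std (map a [0..<k]) = skew_sum {..<k} (\<lambda>b. prod_list (map b [0..<k])) a"
proof -
  have "permute_list \<sigma> (map a [0..<k]) = map (a \<circ> \<sigma>) [0..<k]" if "\<sigma> permutes {..<k}" for \<sigma>
    using permutes_in_image[OF that] by (simp add: permute_list_def)
  then show ?thesis by (simp add: s_std_def skew_sum_def)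
qed

lemma equivariant_s_std:
  assumes "distinct ps"
  shows "equivariant (set ps) (\<lambda>a :: nat \<Rightarrow> 'n::finite Diff. s_std (map a ps))"
proof -
  let ?k = "length ps"
  have "equivariant {..<?k} (\<lambda>a :: nat \<Rightarrow> 'n Diff. s_std (map a [0..<?k]))"
    unfolding s_std_eq_skew_sum
    using equivariant_skew_sum[OF equivariant_prod_list[of "[0..<?k]"], of "{..<?k}"]
    by (simp add: atLeast0LessThan)
  then have "equivariant ((!) ps ` {..<?k}) (\<lambda>a :: nat \<Rightarrow> 'n Diff. s_std (map (a \<circ> (!) ps) [0..<?k]))"
    by (rule equivariant_reindex) (use assms in \<open>simp add: inj_on_nth\<close>)
  moreover have "(!) ps ` {..<?k} = set ps" by (auto simp: in_set_conv_nth)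
  moreover have "map (a \<circ> (!) ps) [0..<?k] = map a ps" for a :: "nat \<Rightarrow> 'n Diff"
    by (metis map_map map_nth)
  ultimately show ?thesis by (simp only:)
qed

lemma map_nth_upd: "map (((!) xs)(i := x)) [0..<length xs] = xs[i := x]"
  by (rule nth_equalityI) (simp_all add: nth_list_update)

lemma linear_op_s_std:
  "i < length Xs \<Longrightarrow> linear_op (\<lambda>x. s_std (Xs[i := x]))"
  using equivariant_linear[OF equivariant_s_std[of "[0..<length Xs]"], of i "(!) Xs"]
  by (simp add: map_nth_upd)

lemma ad_s_std:
  "ad X (s_std Xs) = (\<Sum>i<length Xs. s_std (Xs[i := ad X (Xs ! i)]))"
  using equivariant_ad[OF equivariant_s_std[of "[0..<length Xs]"], of X "(!) Xs"]
  by (simp add: map_nth_upd map_nth atLeast0LessThan)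

lemma s_std_permute:
  assumes "\<sigma> permutes {..<length Xs}"
  shows "s_std (permute_list \<sigma> Xs) = of_int (sign \<sigma>) * s_std Xs"
proof -
  let ?k = "length Xs"
  have "permute_list \<sigma> Xs = map ((!) Xs \<circ> \<sigma>) [0..<?k]" by (simp add: permute_list_def)
  then show ?thesis
    using skew_sum_permute[OF _ assms, of "\<lambda>b. prod_list (map b [0..<?k])" "(!) Xs"]
    by (simp add: map_nth flip: s_std_eq_skew_sum)
qed

lemma s_std_repeated:
  assumes "i < length Xs" "j < length Xs" "i \<noteq> j" "Xs ! i = Xs ! j"
  shows "s_std Xs = 0"
  using skew_sum_eq_0[of "{..<length Xs}" i j "(!) Xs" "\<lambda>b. prod_list (map b [0..<length Xs])"] assms
  by (simp add: map_nth flip: s_std_eq_skew_sum)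

text \<open>By skew-symmetry, an argument matters only modulo the span of the others.\<close>

lemma s_std_upd_span_others:
  assumes i: "i < length Xs" and y: "y \<in> Diff.span (set Xs - {Xs ! i})"
  shows "s_std (Xs[i := y]) = 0"
  using y
proof (induction rule: Diff.span_induct)
  case base
  show ?case
    using linear_op_s_std[OF i]
    by (intro Diff.subspaceI)
       (simp_all add: Diff_pair.linear_0[OF linear_op_s_std[OF i]] linear_op_add[OF linear_op_s_std[OF i]]
          linear_op_scale[OF linear_op_s_std[OF i]])
next
  case (step x)
  then obtain j where "j < length Xs" "x = Xs ! j" "i \<noteq> j" by (auto simp: in_set_conv_nth)
  then show ?case using i by (intro s_std_repeated[of i _ j]) auto
qed

lemma s_std_apply_1:
  assumes "Xs \<noteq> []" "\<And>X. X \<in> set Xs \<Longrightarrow> Diff_apply X 1 = 0"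
  shows "Diff_apply (s_std Xs) 1 = 0"
proof -
  have prod: "Diff_apply (prod_list Ys) 1 = 0" if "Ys \<noteq> []" "\<And>X. X \<in> set Ys \<Longrightarrow> Diff_apply X 1 = 0"
    for Ys :: "'a Diff list"
    using that by (cases Ys) simp_all
  have "Diff_apply (prod_list (permute_list \<sigma> Xs)) 1 = 0" if "\<sigma> permutes {..<length Xs}" for \<sigma>
    by (rule prod) (use assms that in auto)
  then show ?thesis by (simp add: s_std_def of_int_mult_eq_scaleD)
qed

lemma Vect_apply_1: "X \<in> Vect \<Longrightarrow> Diff_apply X 1 = 0"
  by (auto simp: Vect_def Diff_apply_vf)

section \<open>Degrees of operators and monomial fields\<close>

definition has_degree :: "int \<Rightarrow> 'n::finite Diff \<Rightarrow> bool" where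
  "has_degree e D \<longleftrightarrow> (\<forall>d p. homogeneous d p \<longrightarrow> homogeneous (d + e) (Diff_apply D p))"

lemma has_degree_scaleD: "has_degree e X \<Longrightarrow> has_degree e (scaleD c X)"
  using homogeneous_mult[OF homogeneous_const] by (force simp: has_degree_def)

lemma has_degree_sum: "(\<And>a. a \<in> A \<Longrightarrow> has_degree e (F a)) \<Longrightarrow> has_degree e (sum F A)"
  by (simp add: has_degree_def homogeneous_sum)

lemma has_degree_mult: "has_degree d X \<Longrightarrow> has_degree e Y \<Longrightarrow> has_degree (d + e) (X * Y)"
  unfolding has_degree_def by (metis Diff_apply_mult add.assoc)

lemma has_degree_prod_list:
  "list_all2 has_degree es Xs \<Longrightarrow> has_degree (sum_list es) (prod_list Xs)"
proof (induction rule: list_all2_induct)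
  case Nil
  then show ?case by (simp add: has_degree_def)
next
  case (Cons e es X Xs)
  then show ?case by (simp add: has_degree_mult)
qed

lemma has_degree_s_std:
  assumes "list_all2 has_degree es Xs"
  shows "has_degree (sum_list es) (s_std Xs)"
  unfolding s_std_def of_int_mult_eq_scaleD
proof (intro has_degree_sum has_degree_scaleD)
  fix \<sigma> assume "\<sigma> \<in> {\<sigma>. \<sigma> permutes {..<length Xs}}"
  then have \<sigma>: "\<sigma> permutes {..<length es}" using list_all2_lengthD[OF assms] by simp
  have "has_degree (sum_list (permute_list \<sigma> es)) (prod_list (permute_list \<sigma> Xs))"
    using assms by (intro has_degree_prod_list) (simp add: list_all2_permute_list_iff[OF \<sigma>])
  also have "sum_list (permute_list \<sigma> es) = sum_list es"
    using mset_permute_list[OF \<sigma>] by (metis sum_mset_sum_list)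
  finally show "has_degree (sum_list es) (prod_list (permute_list \<sigma> Xs))" .
qed

lemma has_degree_vf:
  fixes u :: "'n::finite \<Rightarrow> 'n U"
  assumes "\<And>i. homogeneous (e + 1) (u i)"
  shows "has_degree e (vf u)"
  unfolding has_degree_def Diff_apply_vf
proof (intro allI impI homogeneous_sum)
  fix d i and p :: "'n U" assume "homogeneous d p"
  from homogeneous_mult[OF assms homogeneous_pd[OF this], of i i]
  show "homogeneous (d + e) (u i * pd i p)" by (simp add: add.commute)
qed

definition monomial_field :: "('n::finite \<Rightarrow>\<^sub>0 nat) \<times> 'n \<Rightarrow> 'n Diff" where
  "monomial_field x = vf (\<lambda>l. if l = snd x then Poly_Mapping.single (fst x) 1 else 0)"

definition field_degree :: "('n::finite \<Rightarrow>\<^sub>0 nat) \<times> 'n \<Rightarrow> int" where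
  "field_degree x = int (mdeg (fst x)) - 1"

lemma has_degree_monomial_field: "has_degree (field_degree x) (monomial_field x)"
  unfolding monomial_field_def by (rule has_degree_vf) (simp add: field_degree_def homogeneous_single)

lemma monomial_field_in_Vect [simp]: "monomial_field x \<in> Vect"
  by (simp add: monomial_field_def)

lemma single_coeff_1_eq_iff: "Poly_Mapping.single \<alpha> (1::complex) = Poly_Mapping.single \<beta> 1 \<longleftrightarrow> \<alpha> = \<beta>"
  by (metis keys_single insert_absorb2 singleton_insert_inj_eq zero_neq_one)

lemma monomial_field_eq_iff: "monomial_field x = monomial_field y \<longleftrightarrow> x = y"
proof
  assume "monomial_field x = monomial_field y"
  then have *: "(if l = snd x then Poly_Mapping.single (fst x) (1::complex) else 0)
      = (if l = snd y then Poly_Mapping.single (fst y) 1 else 0)" for l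
    by (simp add: monomial_field_def vf_eq_iff fun_eq_iff)
  have "Poly_Mapping.single (fst x) (1::complex) \<noteq> 0" by (metis lookup_single_eq lookup_zero zero_neq_one)
  with *[of "snd x"] show "x = y"
    by (auto simp: single_coeff_1_eq_iff prod_eq_iff split: if_splits)
qed simp

lemma Diff_apply_partial [simp]: "Diff_apply (monomial_field (0, j)) f = pd j f"
  by (simp add: monomial_field_def Diff_apply_vf if_distrib if_distribR cong: if_cong)

lemma Vect_subset_span_monomial_field: "Vect \<subseteq> Diff.span (range monomial_field)"
proof -
  have *: "vf (\<lambda>l. if l = i then p else 0) \<in> Diff.span (range monomial_field)" for i :: 'a and p
  proof (induction p rule: monomial_induct)
    case (1 p q)
    have "vf (\<lambda>l. if l = i then p + q else 0)
        = vf (\<lambda>l. if l = i then p else 0) + vf (\<lambda>l. if l = i then q else 0)"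
      by (simp add: vf_add vf_eq_iff fun_eq_iff)
    with 1 show ?case by (simp add: Diff.span_add)
  next
    case (2 c p)
    have "vf (\<lambda>l. if l = i then const c * p else 0) = scaleD c (vf (\<lambda>l. if l = i then p else 0))"
      by (simp add: vf_scale vf_eq_iff fun_eq_iff)
    with 2 show ?case by (simp add: Diff.span_scale)
  next
    case (3 \<beta>)
    have "vf (\<lambda>l. if l = i then Poly_Mapping.single \<beta> 1 else 0) = monomial_field (\<beta>, i)"
      by (simp add: monomial_field_def cong: if_cong)
    then show ?case by (simp add: Diff.span_base)
  qed
  show ?thesis
  proof
    fix X :: "'a Diff" assume "X \<in> Vect"
    then obtain u where "X = vf u" by (auto simp: Vect_def)
    then have "X = (\<Sum>i\<in>UNIV. vf (\<lambda>l. if l = i then u i else 0))"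
      by (simp add: vf_sum)
    with * show "X \<in> Diff.span (range monomial_field)" by (auto intro: Diff.span_sum)
  qed
qed

section \<open>Detecting zero by constant terms\<close>

text \<open>The span may be taken in each argument separately; the generators \<open>G p\<close>
  depend on the position, which allows some arguments to be held fixed.\<close>

lemma multilinear_span_induct:
  fixes a :: "nat \<Rightarrow> 'n::finite Diff"
  assumes "finite S"
    and sub: "\<And>a p. p \<in> S \<Longrightarrow> Diff.subspace {x. P (a(p := x))}"
    and base: "\<And>a. (\<And>p. p \<in> S \<Longrightarrow> a p \<in> G p) \<Longrightarrow> P a"
    and a: "\<And>p. p \<in> S \<Longrightarrow> a p \<in> Diff.span (G p)"
  shows "P a"
proof -
  have "P a" if "T \<subseteq> S" "\<And>p. p \<in> T \<Longrightarrow> a p \<in> Diff.span (G p)" "\<And>p. p \<in> S - T \<Longrightarrow> a p \<in> G p" for T a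
    using finite_subset[OF that(1) assms(1)] that
  proof (induction T arbitrary: a rule: finite_induct)
    case empty
    then show ?case by (intro base) auto
  next
    case (insert q T)
    have q: "a q \<in> Diff.span (G q)" using insert.prems by simp
    have "P (a(q := a q))"
      using q
    proof (induction rule: Diff.span_induct)
      case base
      show ?case by (rule sub) (use insert.prems in auto)
    next
      case (step x)
      show ?case by (rule insert.IH) (use insert step in auto)
    qed
    then show ?case by simp
  qed
  from this[of S] a show ?thesis by blast
qed

lemma subspace_const_term_eq_0:
  assumes "linear_op F"
  shows "Diff.subspace {x. const_term (Diff_apply (F x) f) = 0}"
  by (rule Diff.subspaceI)
     (simp_all add: linear_op_add[OF assms] linear_op_scale[OF assms] Diff_pair.linear_0[OF assms]
        lookup_add)

text \<open>Compatibility with the brackets by \<open>\<partial>_j\<close> says that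
  \<open>\<partial>_j (\<Phi> a f)\<close> is \<open>\<Phi> a (\<partial>_j f)\<close> plus a
  sum of terms \<open>\<Phi> a' f\<close>. By induction on the exponent, all Taylor coefficients
  of \<open>\<Phi> a f\<close> are therefore combinations of constant terms of values of
  \<open>\<Phi>\<close>, and these reduce to monomial arguments by multilinearity.\<close>

lemma eq_0_if_const_terms_eq_0:
  fixes \<Phi> :: "(nat \<Rightarrow> 'n::finite Diff) \<Rightarrow> 'n Diff"
  assumes S: "finite S"
    and lin: "\<And>a p. p \<in> S \<Longrightarrow> linear_op (\<lambda>x. \<Phi> (a(p := x)))"
    and der: "\<And>a j. (\<And>p. p \<in> S \<Longrightarrow> a p \<in> Vect) \<Longrightarrow> ad (monomial_field (0, j)) (\<Phi> a)
                = (\<Sum>p\<in>S. \<Phi> (a(p := ad (monomial_field (0, j)) (a p))))"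
    and mono: "\<And>a \<beta>. (\<And>p. p \<in> S \<Longrightarrow> a p \<in> range monomial_field) \<Longrightarrow>
                 const_term (Diff_apply (\<Phi> a) (Poly_Mapping.single \<beta> 1)) = 0"
    and a: "\<And>p. p \<in> S \<Longrightarrow> a p \<in> Vect"
  shows "\<Phi> a = 0"
proof -
  have ct: "const_term (Diff_apply (\<Phi> a) f) = 0" if "\<And>p. p \<in> S \<Longrightarrow> a p \<in> Vect" for a f
  proof (induction f rule: monomial_induct)
    case (3 \<beta>)
    show ?case
      by (rule multilinear_span_induct[OF S, where G = "\<lambda>_. range monomial_field" and
            P = "\<lambda>a. const_term (Diff_apply (\<Phi> a) (Poly_Mapping.single \<beta> 1)) = 0"])
         (use that Vect_subset_span_monomial_field in \<open>auto intro: subspace_const_term_eq_0 lin mono\<close>)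
  qed (simp_all add: lookup_add)
  have "Poly_Mapping.lookup (Diff_apply (\<Phi> a) f) \<gamma> = 0"
    if "\<And>p. p \<in> S \<Longrightarrow> a p \<in> Vect" "mdeg \<gamma> = d" for d \<gamma> a f
    using that
  proof (induction d arbitrary: \<gamma> a f)
    case 0
    then show ?case using ct by simp
  next
    case (Suc d)
    obtain j \<beta> where \<gamma>: "\<gamma> = \<beta> + Poly_Mapping.single j 1" and \<beta>: "mdeg \<beta> = d"
      using mdeg_Suc_cases[OF Suc.prems(2)] by blast
    let ?d = "monomial_field (0, j)"
    have "Poly_Mapping.lookup (Diff_apply (\<Phi> (a(p := ad ?d (a p)))) f) \<beta> = 0" if "p \<in> S" for p
      using Suc.prems(1) that by (intro Suc.IH[OF _ \<beta>]) (auto intro: ad_in_Vect)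
    then have "Poly_Mapping.lookup (Diff_apply (ad ?d (\<Phi> a)) f) \<beta> = 0"
      by (simp add: der[OF Suc.prems(1)] lookup_sum)
    moreover have "Poly_Mapping.lookup (Diff_apply (\<Phi> a) (pd j f)) \<beta> = 0"
      by (rule Suc.IH[OF Suc.prems(1) \<beta>])
    ultimately have "Poly_Mapping.lookup (pd j (Diff_apply (\<Phi> a) f)) \<beta> = 0"
      by (simp add: ad_alt lookup_minus)
    then show ?case by (simp add: lookup_pd \<gamma> del: of_nat_Suc)
  qed
  with a show ?thesis by (intro Diff_eqI poly_mapping_eqI) simp
qed

section \<open>Counting monomial fields\<close>

definition affine_indices :: "(('n::finite \<Rightarrow>\<^sub>0 nat) \<times> 'n) set" where
  "affine_indices = {x. mdeg (fst x) \<le> 1}"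

lemma affine_indices_eq:
  "affine_indices = range (Pair 0) \<union> (\<lambda>(j, i). (Poly_Mapping.single j 1, i)) ` (UNIV \<times> UNIV)"
proof -
  have "x \<in> range (Pair 0) \<union> (\<lambda>(j, i). (Poly_Mapping.single j 1, i)) ` (UNIV \<times> UNIV)"
    if x: "mdeg (fst x) \<le> 1" for x :: "('a \<Rightarrow>\<^sub>0 nat) \<times> 'a"
  proof (cases "mdeg (fst x) = 0")
    case True
    then show ?thesis by (cases x) simp
  next
    case False
    with x have "mdeg (fst x) = 1" by linarith
    then obtain j where "fst x = Poly_Mapping.single j 1" by (rule mdeg_1_cases)
    then show ?thesis by (cases x) (auto intro: image_eqI[of _ _ "(j, snd x)"])
  qed
  then show ?thesis by (auto simp: affine_indices_def)
qed

lemma finite_affine_indices: "finite affine_indices"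
  by (simp add: affine_indices_eq)

lemma single_exponent_1_eq_iff: "Poly_Mapping.single j (1::nat) = Poly_Mapping.single k 1 \<longleftrightarrow> j = k"
  by (metis lookup_single_eq lookup_single_not_eq zero_neq_one)

lemma sum_affine_indices:
  fixes f :: "('n::finite \<Rightarrow>\<^sub>0 nat) \<times> 'n \<Rightarrow> 'b::comm_monoid_add"
  shows "sum f affine_indices
     = (\<Sum>i\<in>UNIV. f (0, i)) + (\<Sum>(j, i)\<in>UNIV \<times> UNIV. f (Poly_Mapping.single j 1, i))"
proof -
  have "inj_on (\<lambda>(j :: 'n, i :: 'n). (Poly_Mapping.single j (1::nat), i)) (UNIV \<times> UNIV)"
    by (auto simp: inj_on_def single_exponent_1_eq_iff[simplified])
  moreover have "range (Pair (0 :: 'n \<Rightarrow>\<^sub>0 nat)) \<inter> (\<lambda>(j :: 'n, i :: 'n). (Poly_Mapping.single j 1, i)) ` (UNIV \<times> UNIV) = {}"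
  proof -
    have "Poly_Mapping.single j (1::nat) \<noteq> 0" for j :: 'n
      by (metis mdeg_0 mdeg_single zero_neq_one)
    then show ?thesis by (auto simp del: One_nat_def)
  qed
  ultimately show ?thesis
    unfolding affine_indices_eq
    by (subst sum.union_disjoint) (simp_all add: sum.reindex inj_on_def case_prod_beta)
qed

lemma sum_affine_defect:
  "(\<Sum>x\<in>(affine_indices :: (('n::finite \<Rightarrow>\<^sub>0 nat) \<times> 'n) set). 1 - field_degree x)
     = (int CARD('n))\<^sup>2 + 2 * int CARD('n)"
  by (simp add: sum_affine_indices field_degree_def power2_eq_square case_prod_beta card_cartesian_product)

lemma card_affine_indices:
  "card (affine_indices :: (('n::finite \<Rightarrow>\<^sub>0 nat) \<times> 'n) set) = CARD('n) + CARD('n) * CARD('n)"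
  unfolding card_eq_sum sum_affine_indices by (simp add: case_prod_beta card_cartesian_product)

text \<open>The summand \<open>2 - \<bar>\<alpha>\<bar>\<close> is positive exactly for the
  affine fields, so the sum over any set is largest for a set that contains all of these and
  otherwise only fields with \<open>\<bar>\<alpha>\<bar> = 2\<close>.\<close>

lemma sum_defect_le:
  fixes J :: "(('n::finite \<Rightarrow>\<^sub>0 nat) \<times> 'n) set"
  assumes J: "finite J"
  shows "(\<Sum>x\<in>J. 1 - field_degree x) \<le> (int CARD('n))\<^sup>2 + 2 * int CARD('n)"
    and "(\<Sum>x\<in>J. 1 - field_degree x) = (int CARD('n))\<^sup>2 + 2 * int CARD('n) \<Longrightarrow>
           affine_indices \<subseteq> J \<and> (\<forall>x\<in>J - affine_indices. mdeg (fst x) = 2)"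
proof -
  let ?f = "\<lambda>x :: ('n \<Rightarrow>\<^sub>0 nat) \<times> 'n. 1 - field_degree x"
  let ?E = "affine_indices :: (('n \<Rightarrow>\<^sub>0 nat) \<times> 'n) set"
  have 1: "sum ?f J = sum ?f (J - ?E) + sum ?f (J \<inter> ?E)"
    using sum.Int_Diff[OF J, of ?f ?E] by linarith
  have 2: "sum ?f ?E = sum ?f (?E - J) + sum ?f (J \<inter> ?E)"
    using sum.Int_Diff[OF finite_affine_indices, of ?f J] by (simp only: Int_commute)
  have 3: "?f x \<le> 0" if "x \<in> J - ?E" for x
    using that by (simp add: affine_indices_def field_degree_def)
  have 4: "?f x > 0" if "x \<in> ?E - J" for x
    using that by (simp add: affine_indices_def field_degree_def)
  have 5: "sum ?f (J - ?E) \<le> 0" by (rule sum_nonpos) (rule 3)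
  have 6: "0 \<le> sum ?f (?E - J)" using 4 by (intro sum_nonneg) force
  from 1 2 5 6 show "sum ?f J \<le> (int CARD('n))\<^sup>2 + 2 * int CARD('n)"
    by (simp add: sum_affine_defect)
  assume "sum ?f J = (int CARD('n))\<^sup>2 + 2 * int CARD('n)"
  with 1 2 5 6 have 7: "sum ?f (J - ?E) = 0" "sum ?f (?E - J) = 0"
    by (simp_all add: sum_affine_defect)
  have "?E - J = {}"
    using sum_pos[of "?E - J" ?f] 4 7(2) finite_affine_indices by force
  moreover have "?f x = 0" if "x \<in> J - ?E" for x
    using sum_nonneg_eq_0_iff[of "J - ?E" "\<lambda>x. - ?f x"] 3 7(1) J that
    by (force simp: sum_negf sum_subtractf)
  ultimately show "?E \<subseteq> J \<and> (\<forall>x\<in>J - ?E. mdeg (fst x) = 2)"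
    by (auto simp: field_degree_def)
qed

section \<open>The borderline case\<close>

text \<open>Fewer linear forms than variables: padded with zero rows they give a singular square
  matrix.\<close>

lemma common_kernel:
  fixes ls :: "('n::finite \<Rightarrow> complex) list"
  assumes "length ls < CARD('n)"
  obtains e m where "e m = 1" "\<And>l. l \<in> set ls \<Longrightarrow> (\<Sum>i\<in>UNIV. l i * e i) = 0"
proof -
  obtain h where h: "bij_betw h (UNIV :: 'n set) {..<CARD('n)}"
    using ex_bij_betw_finite_nat[of "UNIV :: 'n set"] by (auto simp: atLeast0LessThan)
  define M :: "complex^'n^'n" where
    "M = (\<chi> r i. if h r < length ls then (ls ! h r) i else 0)"
  \<comment> \<open>Row \<open>r\<close> is one of the padding rows.\<close>
  obtain r where r: "h r = length ls" using h assms by (metis bij_betw_iff_bijections lessThan_iff)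
  have "row r M = 0" by (simp add: M_def row_def vec_eq_iff r)
  then have "det M = 0" by (rule det_zero_row)
  then have "\<not> (\<exists>B. B ** M = mat 1)"
    using invertible_det_nz[of M] by (simp add: invertible_left_inverse)
  then obtain x where x: "M *v x = 0" "x \<noteq> 0"
    by (auto simp: matrix_left_invertible_ker)
  obtain m where m: "x $ m \<noteq> 0" using x(2) by (auto simp: vec_eq_iff)
  show ?thesis
  proof (rule that[of "\<lambda>i. x $ i / x $ m" m])
    fix l assume "l \<in> set ls"
    then obtain k where k: "k < length ls" "l = ls ! k" by (auto simp: in_set_conv_nth)
    obtain q where q: "h q = k"
      using h k(1) assms by (metis bij_betw_iff_bijections lessThan_iff less_trans)
    have "(M *v x) $ q = 0" using x(1) by simp
    then have "(\<Sum>i\<in>UNIV. l i * x $ i) = 0"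
      by (simp add: matrix_vector_mult_def M_def q k)
    then show "(\<Sum>i\<in>UNIV. l i * (x $ i / x $ m)) = 0"
      by (simp flip: sum_divide_distrib)
  qed (use m in simp)
qed

definition linear_form :: "('n::finite \<Rightarrow> complex) \<Rightarrow> 'n U" where
  "linear_form a = (\<Sum>j\<in>UNIV. const (a j) * var j)"

lemma const_term_var: "const_term (var i) = 0" for i :: "'n::finite"
  unfolding var_def by (rule const_term_homogeneous[OF homogeneous_single]) simp

lemma const_sum: "const (sum f A) = (\<Sum>a\<in>A. const (f a))"
  by (induction A rule: infinite_finite_induct) (simp_all add: const_add)

lemma pd_linear_form: "pd k (linear_form a) = const (a k)"
  by (simp add: linear_form_def pd_sum pd_const_mult pd_var if_distrib cong: if_cong)

text \<open>The field \<open>l\<^sup>2 v\<close> for a linear form \<open>l\<close> and a vector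
  \<open>v\<close>.\<close>

definition square_field :: "('n::finite \<Rightarrow> complex) \<Rightarrow> ('n \<Rightarrow> complex) \<Rightarrow> 'n Diff" where
  "square_field l v = vf (\<lambda>i. const (v i) * (linear_form l * linear_form l))"

text \<open>The field \<open>x_m \<partial>_e\<close>, where \<open>\<partial>_e\<close> is the
  derivative in direction \<open>e\<close>.\<close>

definition shear_field :: "'n::finite \<Rightarrow> ('n \<Rightarrow> complex) \<Rightarrow> 'n Diff" where
  "shear_field m e = vf (\<lambda>i. const (e i) * var m)"

lemma mult_delta_right: "c * (if P then x else 0) = (if P then c * x else (0 :: 'a::mult_zero))"
  by simp

lemma ad_shear_vf:
  "ad (shear_field m e) (vf u)
     = vf (\<lambda>i. var m * (\<Sum>j\<in>UNIV. const (e j) * pd j (u i)) - const (e i) * u m)"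
proof -
  have "pd j (const (e i) * var m) = (if j = m then const (e i) else 0)" for i j
    by (simp add: pd_const_mult pd_var)
  then have "(\<Sum>j\<in>UNIV. u j * pd j (const (e i) * var m)) = const (e i) * u m" for i
    by (simp add: mult_delta_right mult.commute)
  then show ?thesis
    by (simp add: shear_field_def ad_vf vf_eq_iff fun_eq_iff sum_distrib_left mult_ac)
qed

lemma ad_shear_partial:
  "ad (shear_field m e) (monomial_field (0, i))
     = (if i = m then - (\<Sum>l\<in>UNIV. scaleD (e l) (monomial_field (0, l))) else 0)"
proof -
  have "(\<Sum>l\<in>UNIV. scaleD (e l) (monomial_field (0, l))) = vf (\<lambda>i. const (e i))"
    by (simp add: monomial_field_def vf_scale vf_sum if_distrib cong: if_cong)
  moreover have "- vf u = vf (\<lambda>i. - u i)" for u :: "'a \<Rightarrow> 'a U"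
    by (rule Diff_eqI) (simp add: Diff_apply_vf uminus_Diff.rep_eq sum_negf)
  moreover have "pd j (if P then 1 else 0) = 0" for j :: 'a and P
    by simp
  ultimately show ?thesis
    unfolding monomial_field_def ad_shear_vf by (auto simp: vf_eq_iff fun_eq_iff simp flip: vf_0 cong: if_cong)
qed

lemma ad_shear_linear:
  "ad (shear_field m e) (monomial_field (Poly_Mapping.single j 1, i))
     = scaleD (e j) (monomial_field (Poly_Mapping.single m 1, i))
       - (if i = m then \<Sum>l\<in>UNIV. scaleD (e l) (monomial_field (Poly_Mapping.single j 1, l)) else 0)"
proof -
  have 1: "(\<Sum>l\<in>UNIV. scaleD (e l) (vf (\<lambda>k. if k = l then var j else 0))) = vf (\<lambda>l. const (e l) * var j)"
    by (simp add: vf_scale vf_sum mult_delta_right)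
  have 2: "vf u - vf v = vf (\<lambda>i. u i - v i)" for u v :: "'a \<Rightarrow> 'a U"
    by (rule Diff_eqI) (simp add: Diff_apply_vf left_diff_distrib sum_subtractf)
  have 3: "(\<Sum>k\<in>UNIV. const (e k) * pd k (if P then var j else 0)) = (if P then const (e j) else 0)" for P
    by (cases P) (simp_all add: pd_var mult_delta_right)
  show ?thesis
    unfolding monomial_field_def fst_conv snd_conv var_def[symmetric] ad_shear_vf 1 3
    by (auto simp: 2 vf_eq_iff fun_eq_iff vf_scale mult.commute)
qed

text \<open>The shear moves points in direction \<open>e\<close>, along which \<open>l\<close>
  is constant, so only the vector \<open>v\<close> is affected.\<close>

lemma ad_shear_square:
  assumes "(\<Sum>j\<in>UNIV. l j * e j) = 0"
  shows "ad (shear_field m e) (square_field l v) = scaleD (- v m) (square_field l e)"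
proof -
  have "(\<Sum>j\<in>UNIV. const (e j) * const (l j)) = const (\<Sum>j\<in>UNIV. l j * e j)"
    by (simp add: const_sum const_mult mult.commute)
  then have 0: "(\<Sum>j\<in>UNIV. const (e j) * const (l j)) = 0" by (simp add: assms)
  have "(\<Sum>j\<in>UNIV. const (e j) * pd j (const (v i) * (linear_form l * linear_form l)))
      = 2 * const (v i) * linear_form l * (\<Sum>j\<in>UNIV. const (e j) * const (l j))" for i
    by (simp add: pd_const_mult pd_mult pd_linear_form sum_distrib_left algebra_simps)
  then have "(\<Sum>j\<in>UNIV. const (e j) * pd j (const (v i) * (linear_form l * linear_form l))) = 0" for i
    by (simp only: 0 mult_zero_right)
  then show ?thesis
    unfolding square_field_def ad_shear_vf
    by (simp add: vf_scale vf_eq_iff fun_eq_iff const_uminus)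
qed

text \<open>If a derivation maps each member of a list to a multiple of it plus a combination of
  the others, it multiplies a skew-symmetric product of the members by its trace. The
  eigenvalues \<open>\<mu>s\<close> are the diagonal entries of \<open>ad L\<close> with respect
  to the list.\<close>

lemma ad_s_std_triangular:
  assumes "list_all2 (\<lambda>X \<mu>. ad L X - scaleD \<mu> X \<in> Diff.span (set Xs - {X})) Xs \<mu>s"
  shows "ad L (s_std Xs) = scaleD (sum_list \<mu>s) (s_std Xs)"
proof -
  have len: "length \<mu>s = length Xs" using list_all2_lengthD[OF assms] by simp
  have "s_std (Xs[i := ad L (Xs ! i)]) = scaleD (\<mu>s ! i) (s_std Xs)" if i: "i < length Xs" for i
  proof -
    note lin = linear_op_s_std[OF i]
    let ?y = "ad L (Xs ! i) - scaleD (\<mu>s ! i) (Xs ! i)"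
    have "s_std (Xs[i := ?y]) = 0"
      using list_all2_nthD[OF assms i] by (rule s_std_upd_span_others[OF i])
    moreover have "s_std (Xs[i := ?y + scaleD (\<mu>s ! i) (Xs ! i)]) = s_std (Xs[i := ?y]) + scaleD (\<mu>s ! i) (s_std Xs)"
      by (simp only: linear_op_add[OF lin] linear_op_scale[OF lin] list_update_id)
    ultimately show ?thesis by simp
  qed
  then show ?thesis
    by (simp add: ad_s_std sum_list_sum_nth len atLeast0LessThan Diff.scale_sum_left)
qed

text \<open>In both of the following lemmas, \<open>e m = 1\<close> makes the coefficient of the
  given field equal to the stated number; the remaining terms are other members of the
  list.\<close>

lemma ad_shear_partial_triangular:
  assumes "e m = 1" "range (\<lambda>l. monomial_field (0, l)) \<subseteq> A"
  shows "ad (shear_field m e) (monomial_field (0, i)) - scaleD (if i = m then - 1 else 0) (monomial_field (0, i))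
    \<in> Diff.span (A - {monomial_field (0, i)})"
proof (cases "i = m")
  case True
  have "(\<Sum>l\<in>UNIV. scaleD (e l) (monomial_field (0, l)))
      = monomial_field (0, m) + (\<Sum>l\<in>UNIV - {m}. scaleD (e l) (monomial_field (0, l)))"
    by (subst sum.remove[of _ m]) (simp_all add: assms(1))
  moreover have "(\<Sum>l\<in>UNIV - {m}. scaleD (e l) (monomial_field (0, l))) \<in> Diff.span (A - {monomial_field (0, m)})"
    using assms(2)
    by (intro Diff.span_sum Diff.span_scale Diff.span_base) (auto simp: monomial_field_eq_iff)
  ultimately show ?thesis using True by (simp add: ad_shear_partial Diff.span_neg)
qed (simp add: ad_shear_partial Diff.span_zero)

lemma ad_shear_linear_triangular:
  assumes "e m = 1" "range (\<lambda>(j, l). monomial_field (Poly_Mapping.single j 1, l)) \<subseteq> A"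
  shows "ad (shear_field m e) (monomial_field (Poly_Mapping.single j 1, i))
      - scaleD ((if j = m then 1 else 0) - (if i = m then 1 else 0)) (monomial_field (Poly_Mapping.single j 1, i))
    \<in> Diff.span (A - {monomial_field (Poly_Mapping.single j 1, i)})"
proof -
  let ?d = "\<lambda>j i. monomial_field (Poly_Mapping.single j 1, i)"
  have A: "?d k l \<in> A" for k l using assms(2) by force
  have inj: "?d k l = ?d j i \<longleftrightarrow> k = j \<and> l = i" for k l
    by (simp add: monomial_field_eq_iff single_exponent_1_eq_iff[simplified])
  have 1: "scaleD (e j) (?d m i) - scaleD (if j = m then 1 else 0) (?d j i) \<in> Diff.span (A - {?d j i})"
  proof (cases "j = m")
    case True
    then show ?thesis by (simp add: assms(1) Diff.span_zero)
  next
    case False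
    then have "?d m i \<in> A - {?d j i}" using A[of m i] inj[of m i] by auto
    with False show ?thesis by (simp add: Diff.span_scale Diff.span_base)
  qed
  have 2: "(if i = m then \<Sum>l\<in>UNIV. scaleD (e l) (?d j l) else 0) - scaleD (if i = m then 1 else 0) (?d j i)
      \<in> Diff.span (A - {?d j i})"
  proof (cases "i = m")
    case True
    have "(\<Sum>l\<in>UNIV. scaleD (e l) (?d j l)) = ?d j m + (\<Sum>l\<in>UNIV - {m}. scaleD (e l) (?d j l))"
      by (subst sum.remove[of _ m]) (simp_all add: assms(1))
    moreover have "(\<Sum>l\<in>UNIV - {m}. scaleD (e l) (?d j l)) \<in> Diff.span (A - {?d j i})"
      using A inj True by (intro Diff.span_sum Diff.span_scale Diff.span_base) auto
    ultimately show ?thesis using True by simp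
  qed (simp add: Diff.span_zero)
  show ?thesis
    using Diff.span_diff[OF 1 2] by (simp only: ad_shear_linear Diff.scale_left_diff_distrib) (simp add: algebra_simps)
qed

definition affine_fields :: "'n::finite list \<Rightarrow> 'n Diff list" where
  "affine_fields is = map (\<lambda>i. monomial_field (0, i)) is @
     map (\<lambda>(j, i). monomial_field (Poly_Mapping.single j 1, i)) (List.product is is)"

text \<open>The bracket by \<open>L = shear_field m e\<close> multiplies the standard polynomial
  by the trace \<open>- 1 - k\<close>, where \<open>k\<close> counts the members of
  \<open>Qs\<close> with eigenvalue \<open>- 1\<close>. Since \<open>L\<close> kills the square
  of \<open>l\<close> and the image of \<open>L\<close> has no constant terms, the constant term
  of the bracket is \<open>0\<close>.\<close>

lemma const_term_s_std_eigen:
  fixes e :: "'n::finite \<Rightarrow> complex"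
  assumes "is": "distinct is" "set is = UNIV"
    and e: "e m = 1"
    and Qs: "\<And>Q. Q \<in> set Qs \<Longrightarrow> ad (shear_field m e) Q = 0 \<or> ad (shear_field m e) Q = - Q"
    and l: "(\<Sum>j\<in>UNIV. l j * e j) = 0"
  shows "const_term (Diff_apply (s_std (affine_fields is @ Qs)) (linear_form l * linear_form l)) = 0"
proof -
  let ?L = "shear_field m e"
  let ?Xs = "affine_fields is @ Qs"
  define \<mu> where "\<mu> Q = (if ad ?L Q = 0 then 0 else - 1 :: complex)" for Q
  define \<mu>s where "\<mu>s = map (\<lambda>i. if i = m then - 1 else 0) is @
     map (\<lambda>(j, i). (if j = m then 1 else 0) - (if i = m then 1 else 0)) (List.product is is) @ map \<mu> Qs"
  define A where "A = set ?Xs"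
  let ?R = "\<lambda>X \<mu>. ad ?L X - scaleD \<mu> X \<in> Diff.span (A - {X})"
  have "list_all2 ?R ?Xs \<mu>s"
    unfolding affine_fields_def \<mu>s_def append_assoc
  proof (intro list_all2_appendI)
    have sub: "range (\<lambda>l. monomial_field (0, l)) \<subseteq> A"
      using "is" by (auto simp: A_def affine_fields_def)
    show "list_all2 ?R (map (\<lambda>i. monomial_field (0, i)) is) (map (\<lambda>i. if i = m then - 1 else 0) is)"
      unfolding list_all2_map1 list_all2_map2
      by (rule list_all2_same[THEN iffD2]) (intro ballI ad_shear_partial_triangular[of e m, OF e sub])
    have sub: "range (\<lambda>(j, l). monomial_field (Poly_Mapping.single j 1, l)) \<subseteq> A"
      using "is" by (auto simp: A_def affine_fields_def)
    show "list_all2 ?R (map (\<lambda>(j, i). monomial_field (Poly_Mapping.single j 1, i)) (List.product is is))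
        (map (\<lambda>(j, i). (if j = m then 1 else 0) - (if i = m then 1 else 0)) (List.product is is))"
      unfolding list_all2_map1 list_all2_map2 case_prod_beta
      by (rule list_all2_same[THEN iffD2])
         (intro ballI ad_shear_linear_triangular[of e m, OF e sub])
    have "ad ?L Q - scaleD (\<mu> Q) Q = 0" if "Q \<in> set Qs" for Q
      using Qs[OF that] by (auto simp: \<mu>_def)
    then show "list_all2 ?R Qs (map \<mu> Qs)"
      unfolding list_all2_map2 by (intro list_all2_same[THEN iffD2]) (simp add: Diff.span_zero)
  qed
  from ad_s_std_triangular[OF this[unfolded A_def]]
  have "ad ?L (s_std ?Xs) = scaleD (sum_list \<mu>s) (s_std ?Xs)" .
  moreover have "const_term (Diff_apply (ad ?L D) (linear_form l * linear_form l)) = 0" for D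
  proof -
    have "Diff_apply ?L (linear_form l * linear_form l)
        = 2 * var m * linear_form l * (\<Sum>j\<in>UNIV. const (e j) * const (l j))"
      by (simp add: shear_field_def Diff_apply_vf pd_mult pd_linear_form sum_distrib_left algebra_simps)
    also have "(\<Sum>j\<in>UNIV. const (e j) * const (l j)) = const (\<Sum>j\<in>UNIV. l j * e j)"
      by (simp add: const_sum const_mult mult.commute)
    finally have "Diff_apply ?L (linear_form l * linear_form l) = 0" by (simp add: l)
    moreover have "const_term (Diff_apply ?L g) = 0" for g
      by (simp add: shear_field_def Diff_apply_vf lookup_sum const_term_mult const_term_var)
    ultimately show ?thesis by (simp add: ad_alt lookup_minus)
  qed
  moreover have "sum_list \<mu>s \<noteq> 0"
  proof -
    have 1: "(\<Sum>i\<leftarrow>is. if i = m then - 1 else 0) = (- 1 :: complex)"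
      using "is" by (simp add: sum_list_distinct_conv_sum_set)
    have "(\<Sum>(j, i)\<leftarrow>List.product is is. (if j = m then 1 else 0) - (if i = m then 1 else 0))
        = (\<Sum>j\<in>set is. \<Sum>i\<in>set is. (if j = m then 1 else 0) - (if i = m then 1 else 0 :: complex))"
      by (subst sum_list_distinct_conv_sum_set)
         (simp_all add: distinct_product "is"(1) sum.cartesian_product)
    \<comment> \<open>The trace on the linear fields is a commutator trace: it changes sign when \<open>i\<close> and \<open>j\<close> are swapped.\<close>
    also have "\<dots> = 0" by (simp only: sum_subtractf, subst sum.swap, simp)
    finally have 2: "(\<Sum>(j, i)\<leftarrow>List.product is is. (if j = m then 1 else 0) - (if i = m then 1 else 0)) = (0 :: complex)" .
    have \<mu>01: "\<mu> Q = 0 \<or> \<mu> Q = - 1" for Q by (simp add: \<mu>_def)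
    have 3: "\<exists>k. sum_list (map \<mu> Qs) = - of_nat k"
    proof (induction Qs)
      case (Cons Q Qs)
      then obtain k where "sum_list (map \<mu> Qs) = - of_nat k" by blast
      then show ?case
        using \<mu>01[of Q] by (auto intro: exI[of _ k] exI[of _ "Suc k"])
    qed (auto intro: exI[of _ 0])
    then obtain k where "sum_list (map \<mu> Qs) = - of_nat k" by blast
    then have "sum_list \<mu>s = - of_nat (Suc k)" by (simp add: \<mu>s_def 1 2)
    then show ?thesis by (metis neg_equal_0_iff_equal of_nat_eq_0_iff nat.distinct(1))
  qed
  ultimately show ?thesis by (metis Diff_apply_scaleD lookup_const_mult mult_eq_0_iff)
qed

text \<open>The polarization step: some leading arguments stay fixed, and the others are reduced
  to generators.\<close>

lemma const_term_s_std_span: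
  assumes base: "\<And>Ys. length Ys = length Qs \<Longrightarrow> (\<And>p. p < length Qs \<Longrightarrow> Ys ! p \<in> G p) \<Longrightarrow>
      const_term (Diff_apply (s_std (Cs @ Ys)) f) = 0"
    and Qs: "\<And>p. p < length Qs \<Longrightarrow> Qs ! p \<in> Diff.span (G p)"
  shows "const_term (Diff_apply (s_std (Cs @ Qs)) f) = 0"
proof -
  let ?r = "length Qs"
  have "const_term (Diff_apply (s_std (Cs @ map ((!) Qs) [0..<?r])) f) = 0"
  proof (rule multilinear_span_induct[where G = G and S = "{..<?r}" and
        P = "\<lambda>a. const_term (Diff_apply (s_std (Cs @ map a [0..<?r])) f) = 0"])
    fix a :: "nat \<Rightarrow> 'a Diff" and p assume p: "p \<in> {..<?r}"
    have "Cs @ map (a(p := x)) [0..<?r] = (Cs @ map a [0..<?r])[length Cs + p := x]" for x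
      by (simp add: list_update_append) (rule nth_equalityI, auto simp: nth_list_update)
    then show "Diff.subspace {x. const_term (Diff_apply (s_std (Cs @ map (a(p := x)) [0..<?r])) f) = 0}"
      using p by (simp add: subspace_const_term_eq_0 linear_op_s_std)
  next
    fix a :: "nat \<Rightarrow> 'a Diff" assume "\<And>p. p \<in> {..<?r} \<Longrightarrow> a p \<in> G p"
    then show "const_term (Diff_apply (s_std (Cs @ map a [0..<?r])) f) = 0"
      by (intro base) simp_all
  qed (use Qs in simp_all)
  then show ?thesis by (simp add: map_nth)
qed

text \<open>There are fewer linear forms than variables, so a common zero \<open>e\<close>
  exists, normalised at some coordinate \<open>m\<close>. For each form \<open>l\<close>, the
  fields \<open>l\<^sup>2 v\<close> with \<open>v = e\<close> or \<open>v m = 0\<close> are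
  eigenvectors of the bracket by \<open>x_m \<partial>_e\<close> and span all \<open>l\<^sup>2
  v\<close>.\<close>

lemma const_term_s_std_squares:
  fixes lvs :: "(('n::finite \<Rightarrow> complex) \<times> ('n \<Rightarrow> complex)) list"
  assumes "is": "distinct is" "set is = UNIV" and "length lvs + 1 < CARD('n)"
  shows "const_term (Diff_apply (s_std (affine_fields is @ map (\<lambda>(l, v). square_field l v) lvs))
           (linear_form l0 * linear_form l0)) = 0"
proof -
  obtain e m where em: "e m = 1" "\<And>l. l \<in> set (l0 # map fst lvs) \<Longrightarrow> (\<Sum>i\<in>UNIV. l i * e i) = 0"
    using common_kernel[of "l0 # map fst lvs"] assms(3) by auto
  define G where "G p = square_field (fst (lvs ! p)) ` {v. v = e \<or> v m = 0}" for p
  show ?thesis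
  proof (rule const_term_s_std_span[where G = G])
    fix Ys assume Ys: "length Ys = length (map (\<lambda>(l, v). square_field l v) lvs)"
      "\<And>p. p < length (map (\<lambda>(l, v). square_field l v) lvs) \<Longrightarrow> Ys ! p \<in> G p"
    have "ad (shear_field m e) Q = 0 \<or> ad (shear_field m e) Q = - Q" if Q: "Q \<in> set Ys" for Q
    proof -
      obtain p where p: "p < length lvs" "Q = Ys ! p"
        using Q Ys(1) by (auto simp: in_set_conv_nth)
      then obtain v where v: "Q = square_field (fst (lvs ! p)) v" "v = e \<or> v m = 0"
        using Ys(2)[of p] by (auto simp: G_def)
      have "(\<Sum>i\<in>UNIV. fst (lvs ! p) i * e i) = 0" using p by (intro em(2)) simp
      from ad_shear_square[OF this, of m v] v em(1) show ?thesis by auto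
    qed
    then show "const_term (Diff_apply (s_std (affine_fields is @ Ys)) (linear_form l0 * linear_form l0)) = 0"
      by (rule const_term_s_std_eigen[of "is" e m, OF "is" em(1)]) (simp_all add: em(2))
  next
    fix p assume "p < length (map (\<lambda>(l, v). square_field l v) lvs)"
    moreover have "square_field l v \<in> Diff.span (square_field l ` {v. v = e \<or> v m = 0})" for l v
    proof -
      have "square_field l v = scaleD (v m) (square_field l e) + square_field l (\<lambda>i. v i - v m * e i)"
        by (simp add: square_field_def vf_scale vf_add vf_eq_iff fun_eq_iff const_mult const_add const_uminus
              left_diff_distrib flip: const_add const_mult distrib_right mult.assoc)
      also have "\<dots> \<in> Diff.span (square_field l ` {v. v = e \<or> v m = 0})"
        by (intro Diff.span_add Diff.span_scale Diff.span_base) (auto simp: em(1))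
      finally show ?thesis .
    qed
    ultimately show "map (\<lambda>(l, v). square_field l v) lvs ! p \<in> Diff.span (G p)"
      by (simp add: G_def case_prod_beta)
  qed
qed

text \<open>The identity \<open>x y = ((x + y)\<^sup>2 - x\<^sup>2 - y\<^sup>2) / 2\<close> for
  variables \<open>x\<close> and \<open>y\<close>.\<close>

lemma quadratic_monomial_polarization:
  fixes \<alpha> :: "'n::finite \<Rightarrow>\<^sub>0 nat"
  assumes "mdeg \<alpha> = 2"
  obtains a b where "Poly_Mapping.single \<alpha> 1 = const (1/2) * (linear_form (\<lambda>i. a i + b i) * linear_form (\<lambda>i. a i + b i))
     + const (- 1/2) * (linear_form a * linear_form a) + const (- 1/2) * (linear_form b * linear_form b)"
proof -
  obtain j \<beta> where 1: "\<alpha> = \<beta> + Poly_Mapping.single j 1" "mdeg \<beta> = 1"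
    using mdeg_Suc_cases[of \<alpha> 1] assms by (metis Suc_1)
  obtain k where 2: "\<beta> = Poly_Mapping.single k 1" using mdeg_1_cases[OF 1(2)] .
  have v: "linear_form (\<lambda>i. if i = l then 1 else 0) = var l" for l :: 'n
    by (simp add: linear_form_def if_distrib if_distribR cong: if_cong)
  have add: "linear_form (\<lambda>i. a i + b i) = linear_form a + linear_form b" for a b :: "'n \<Rightarrow> complex"
    by (simp add: linear_form_def const_add distrib_right sum.distrib)
  have "x * y = h * ((x + y) * (x + y)) + - h * (x * x) + - h * (y * y)" if "h + h = 1" for h x y :: "'n U"
  proof -
    have "h * ((x + y) * (x + y)) + - h * (x * x) + - h * (y * y) = (h + h) * (x * y)"
      by (simp add: algebra_simps)
    then show ?thesis by (simp add: that)
  qed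
  from this[of "const (1/2)" "var k" "var j"]
  have "var k * var j = const (1/2) * ((var k + var j) * (var k + var j))
      + const (- 1/2) * (var k * var k) + const (- 1/2) * (var j * var j)"
    using const_uminus[of "1/2", where 'a = 'n] by (simp flip: const_add)
  moreover have "var k * var j = Poly_Mapping.single \<alpha> (1 :: complex)"
    by (simp add: 1(1) 2 var_def mult_single)
  ultimately show ?thesis
    using that[of "\<lambda>i. if i = k then 1 else 0" "\<lambda>i. if i = j then 1 else 0"] by (simp only: add v)
qed

lemma const_term_s_std_borderline:
  fixes xs :: "(('n::finite \<Rightarrow>\<^sub>0 nat) \<times> 'n) list"
  assumes "is": "distinct is" "set is = UNIV" and "length xs + 1 < CARD('n)"
    and xs: "\<And>x. x \<in> set xs \<Longrightarrow> mdeg (fst x) = 2" and \<beta>: "mdeg \<beta> = 2"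
  shows "const_term (Diff_apply (s_std (affine_fields is @ map monomial_field xs)) (Poly_Mapping.single \<beta> 1)) = 0"
proof -
  have "const_term (Diff_apply (s_std (affine_fields is @ map monomial_field xs)) (linear_form l * linear_form l)) = 0"
    for l :: "'n \<Rightarrow> complex"
  proof (rule const_term_s_std_span[where G = "\<lambda>_. range (\<lambda>(l, v). square_field l v)"])
    fix Ys :: "'n Diff list"
    assume Ys: "length Ys = length (map monomial_field xs)"
      "\<And>p. p < length (map monomial_field xs) \<Longrightarrow> Ys ! p \<in> range (\<lambda>(l, v). square_field l v)"
    then have "\<forall>Y\<in>set Ys. \<exists>x. Y = (\<lambda>(l, v). square_field l v) x"
      by (metis in_set_conv_nth rangeE)
    then obtain lvs where "Ys = map (\<lambda>(l, v). square_field l v) lvs" by (metis ex_map_conv)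
    with Ys(1) assms(3) show "const_term (Diff_apply (s_std (affine_fields is @ Ys)) (linear_form l * linear_form l)) = 0"
      using const_term_s_std_squares[OF "is", of lvs l] by simp
  next
    fix p assume p: "p < length (map monomial_field xs)"
    obtain \<alpha> i where x: "xs ! p = (\<alpha>, i)" by fastforce
    with xs[of "xs ! p"] p have "mdeg \<alpha> = 2" by (metis fst_conv length_map nth_mem)
    then obtain a b where ab: "Poly_Mapping.single \<alpha> 1 = const (1/2) * (linear_form (\<lambda>i. a i + b i) * linear_form (\<lambda>i. a i + b i))
     + const (- 1/2) * (linear_form a * linear_form a) + const (- 1/2) * (linear_form b * linear_form b)"
      by (rule quadratic_monomial_polarization)
    let ?v = "\<lambda>l. if l = i then 1 else 0"
    have "monomial_field (\<alpha>, i) = scaleD (1/2) (square_field (\<lambda>i. a i + b i) ?v)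
        + scaleD (- 1/2) (square_field a ?v) + scaleD (- 1/2) (square_field b ?v)"
      by (simp add: monomial_field_def square_field_def vf_scale vf_add vf_eq_iff fun_eq_iff ab cong: if_cong)
    also have "\<dots> \<in> Diff.span (range (\<lambda>(l, v). square_field l v))"
      by (intro Diff.span_add Diff.span_scale Diff.span_base) auto
    finally show "map monomial_field xs ! p \<in> Diff.span (range (\<lambda>(l, v). square_field l v))"
      using p x by simp
  qed
  moreover obtain a b where "Poly_Mapping.single \<beta> 1 = const (1/2) * (linear_form (\<lambda>i. a i + b i) * linear_form (\<lambda>i. a i + b i))
     + const (- 1/2) * (linear_form a * linear_form a) + const (- 1/2) * (linear_form b * linear_form b)"
    using \<beta> by (rule quadratic_monomial_polarization)
  ultimately show ?thesis by (simp add: lookup_add)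
qed

section \<open>Standard polynomials of many vector fields\<close>

text \<open>Skew-symmetry excludes repeated fields, and homogeneity forces total degree
  \<open>0\<close>.\<close>

lemma const_term_s_std_monomial:
  fixes xs :: "(('n::finite \<Rightarrow>\<^sub>0 nat) \<times> 'n) list"
  assumes nz: "const_term (Diff_apply (s_std (map monomial_field xs)) (Poly_Mapping.single \<beta> 1)) \<noteq> 0"
  shows "distinct xs" and "(\<Sum>x\<in>set xs. field_degree x) + int (mdeg \<beta>) = 0"
    and "int (length xs) + int (mdeg \<beta>) = (\<Sum>x\<in>set xs. 1 - field_degree x)"
proof -
  show dist: "distinct xs"
    unfolding distinct_conv_nth
  proof (intro allI impI notI)
    fix i j assume "i < length xs" "j < length xs" "i \<noteq> j" "xs ! i = xs ! j"
    then have "s_std (map monomial_field xs) = 0" by (intro s_std_repeated[of i _ j]) simp_all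
    with nz show False by simp
  qed
  have "list_all2 has_degree (map field_degree xs) (map monomial_field xs)"
    by (simp add: list_all2_map1 list_all2_map2 list_all2_same has_degree_monomial_field)
  then have "has_degree (sum_list (map field_degree xs)) (s_std (map monomial_field xs))"
    by (rule has_degree_s_std)
  then have "homogeneous (int (mdeg \<beta>) + sum_list (map field_degree xs))
      (Diff_apply (s_std (map monomial_field xs)) (Poly_Mapping.single \<beta> 1))"
    using homogeneous_single unfolding has_degree_def by blast
  with nz have "int (mdeg \<beta>) + sum_list (map field_degree xs) = 0"
    using const_term_homogeneous by blast
  with dist show *: "(\<Sum>x\<in>set xs. field_degree x) + int (mdeg \<beta>) = 0"
    by (simp add: sum_list_distinct_conv_sum_set)
  show "int (length xs) + int (mdeg \<beta>) = (\<Sum>x\<in>set xs. 1 - field_degree x)"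
    using * distinct_card[OF dist] by (simp add: sum_subtractf)
qed

text \<open>The count allows a nonzero constant term only in the case of equality, where all
  affine fields occur, together with quadratic ones. Reordering the arguments then leads to the
  borderline case.\<close>

lemma const_term_s_std_monomial_eq_0:
  fixes xs :: "(('n::finite \<Rightarrow>\<^sub>0 nat) \<times> 'n) list"
  assumes "length xs + 2 \<ge> CARD('n)\<^sup>2 + 2 * CARD('n)" "mdeg \<beta> \<ge> 2"
  shows "const_term (Diff_apply (s_std (map monomial_field xs)) (Poly_Mapping.single \<beta> 1)) = 0"
proof (rule ccontr)
  let ?n = "CARD('n)"
  let ?E = "affine_indices :: (('n \<Rightarrow>\<^sub>0 nat) \<times> 'n) set"
  assume nz: "\<not> ?thesis"
  note props = const_term_s_std_monomial[OF nz]
  have ge: "int (length xs) + 2 \<ge> (int ?n)\<^sup>2 + 2 * int ?n"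
    using assms(1) by (metis (mono_tags, lifting) of_nat_add of_nat_le_iff of_nat_mult of_nat_numeral of_nat_power)
  note le = sum_defect_le(1)[of "set xs"]
  \<comment> \<open>The bound is attained, so all inequalities in the count are equalities.\<close>
  have \<beta>: "mdeg \<beta> = 2" and len: "int (length xs) + 2 = (int ?n)\<^sup>2 + 2 * int ?n"
    using ge le props(3) assms(2) by simp_all
  have E: "?E \<subseteq> set xs" "\<And>x. x \<in> set xs - ?E \<Longrightarrow> mdeg (fst x) = 2"
    using sum_defect_le(2)[of "set xs"] props(3) len \<beta> by auto
  obtain ys where ys: "set ys = set xs - ?E" "distinct ys"
    using finite_distinct_list[of "set xs - ?E"] by auto
  obtain "is" :: "'n list" where "is": "distinct is" "set is = UNIV"
    using finite_distinct_list[of "UNIV :: 'n set"] by auto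
  define zs :: "(('n \<Rightarrow>\<^sub>0 nat) \<times> 'n) list" where "zs = map (Pair 0) is @ map (\<lambda>(j, i). (Poly_Mapping.single j 1, i)) (List.product is is)"
  have fields: "map monomial_field zs = affine_fields is"
    by (simp add: zs_def affine_fields_def case_prod_beta)
  have set_zs: "set zs = ?E"
    using "is" by (simp add: zs_def affine_indices_eq)
  have "length zs = card ?E"
    using "is" distinct_card[of "is"] by (simp add: zs_def card_affine_indices)
  then have dist_zs: "distinct zs" using set_zs by (metis card_distinct)
  have "mset xs = mset (zs @ ys)"
    by (rule set_eq_iff_mset_eq_distinct[THEN iffD1]) (use E(1) ys set_zs dist_zs props(1) in auto)
  then obtain p where p: "p permutes {..<length (zs @ ys)}" "permute_list p (zs @ ys) = xs"
    by (rule mset_eq_permutation)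
  have "length xs = card ?E + length ys"
    using p(2) \<open>length zs = card ?E\<close> by (metis length_append length_permute_list)
  then have "length ys + 2 = ?n" using len
    by (simp add: card_affine_indices power2_eq_square flip: of_nat_mult)
  then have "const_term (Diff_apply (s_std (affine_fields is @ map monomial_field ys)) (Poly_Mapping.single \<beta> 1)) = 0"
    using E(2) ys(1) by (intro const_term_s_std_borderline "is" \<beta>) auto
  moreover have "map monomial_field xs = permute_list p (map monomial_field (zs @ ys))"
    by (simp only: permute_list_map[OF p(1)] p(2))
  then have "s_std (map monomial_field xs)
      = of_int (sign p) * s_std (affine_fields is @ map monomial_field ys)"
    using s_std_permute[of p "map monomial_field (zs @ ys)"] p(1)
    by (simp only: length_map) (simp add: fields)
  ultimately show False
    using nz by (simp add: of_int_mult_eq_scaleD)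
qed

text \<open>The difference of the two sides annihilates polynomials of degree at most
  \<open>1\<close>, while on a monomial of degree at least \<open>2\<close> a first-order
  operator without constant term has constant term \<open>0\<close>. So only the vanishing of
  constant terms of \<open>s_std\<close> on such monomials remains.\<close>

lemma s_std_eq_first_order:
  fixes Xs :: "'n::finite Diff list"
  assumes len: "length Xs + 2 \<ge> CARD('n)\<^sup>2 + 2 * CARD('n)" and Xs: "set Xs \<subseteq> Vect"
  shows "s_std Xs = first_order (s_std Xs)"
proof -
  let ?k = "length Xs"
  have "CARD('n)\<^sup>2 \<ge> 1" "CARD('n) \<ge> 1" by (simp_all add: Suc_leI)
  with len have k: "?k \<noteq> 0" by linarith
  define \<Psi> where "\<Psi> a = s_std (map a [0..<?k])" for a :: "nat \<Rightarrow> 'n Diff"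
  have \<Psi>: "equivariant {..<?k} \<Psi>"
    using equivariant_s_std[of "[0..<?k]"] by (simp add: \<Psi>_def[abs_def] atLeast0LessThan)
  note linF = linear_op_first_order
  have kills: "Diff_apply (\<Psi> a) 1 = 0" if "\<And>p. p \<in> {..<?k} \<Longrightarrow> a p \<in> Vect" for a
    unfolding \<Psi>_def by (rule s_std_apply_1) (use k that in \<open>auto intro: Vect_apply_1\<close>)
  have "\<Psi> ((!) Xs) - first_order (\<Psi> ((!) Xs)) = 0"
  proof (rule eq_0_if_const_terms_eq_0[of "{..<?k}" "\<lambda>a. \<Psi> a - first_order (\<Psi> a)"])
    fix a p assume "p \<in> {..<?k}"
    note lin = equivariant_linear[OF \<Psi> this]
    show "linear_op (\<lambda>x. \<Psi> (a(p := x)) - first_order (\<Psi> (a(p := x))))"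
      by (rule linear_opI)
         (simp_all add: linear_op_add[OF lin] linear_op_scale[OF lin] linear_op_add[OF linF]
            linear_op_scale[OF linF] Diff.scale_right_diff_distrib)
  next
    fix a and j :: 'n assume "\<And>p. p \<in> {..<?k} \<Longrightarrow> a p \<in> (Vect :: 'n Diff set)"
    then have 1: "Diff_apply (\<Psi> a) 1 = 0" by (rule kills)
    let ?d = "monomial_field (0, j)"
    have commutes: "first_order (ad ?d (\<Psi> a)) = ad ?d (first_order (\<Psi> a))"
      unfolding monomial_field_def by (rule first_order_ad_affine) (simp_all add: 1)
    then show "ad ?d (\<Psi> a - first_order (\<Psi> a))
        = (\<Sum>p<?k. \<Psi> (a(p := ad ?d (a p))) - first_order (\<Psi> (a(p := ad ?d (a p)))))"
      by (simp add: Diff_pair.linear_diff[OF linear_op_ad] equivariant_ad[OF \<Psi>] sum_subtractf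
          Diff_pair.linear_sum[OF linF] flip: commutes)
  next
    fix a and \<beta> :: "'n \<Rightarrow>\<^sub>0 nat" assume a: "\<And>p. p \<in> {..<?k} \<Longrightarrow> a p \<in> range (monomial_field :: _ \<Rightarrow> 'n Diff)"
    let ?f = "Poly_Mapping.single \<beta> (1 :: complex)"
    have "a p = monomial_field (inv monomial_field (a p))" if "p < ?k" for p
      using a[of p] that by (simp add: f_inv_into_f)
    then obtain xs where xs: "map a [0..<?k] = map monomial_field xs" "length xs = ?k"
      by (intro that[of "map (\<lambda>p. inv monomial_field (a p)) [0..<?k]"]) simp_all
    consider "mdeg \<beta> = 0" | "mdeg \<beta> = 1" | "mdeg \<beta> \<ge> 2" by linarith
    then show "const_term (Diff_apply (\<Psi> a - first_order (\<Psi> a)) ?f) = 0"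
    proof cases
      case 1
      have "Diff_apply (\<Psi> a) 1 = 0" by (rule kills) (use a in force)
      with 1 show ?thesis by (simp add: Vect_apply_1)
    next
      case 2
      then obtain i where "?f = var i" by (metis mdeg_1_cases var_def)
      then show ?thesis by (simp add: first_order_def) (simp add: vcoeff_def)
    next
      case 3
      have "const_term (pd i ?f) = 0" for i
        by (rule const_term_homogeneous[OF homogeneous_pd[OF homogeneous_single]]) (use 3 in simp)
      then have "const_term (Diff_apply (first_order (\<Psi> a)) ?f) = 0"
        by (simp add: first_order_def Diff_apply_vf lookup_sum const_term_mult)
      moreover have "const_term (Diff_apply (\<Psi> a) ?f) = 0"
        unfolding \<Psi>_def xs(1) using len xs(2) 3
        by (intro const_term_s_std_monomial_eq_0) simp_all
      ultimately show ?thesis by (simp add: lookup_minus)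
    qed
  qed (use Xs in auto)
  then show ?thesis by (simp add: \<Psi>_def map_nth)
qed

lemma s_std_eq_0:
  fixes Xs :: "'n::finite Diff list"
  assumes len: "length Xs \<ge> CARD('n)\<^sup>2 + 2 * CARD('n)" and Xs: "set Xs \<subseteq> Vect"
  shows "s_std Xs = 0"
proof -
  let ?k = "length Xs"
  have "CARD('n) \<ge> 1" by (simp add: Suc_leI)
  with len have k: "?k \<noteq> 0" by linarith
  define \<Psi> where "\<Psi> a = s_std (map a [0..<?k])" for a :: "nat \<Rightarrow> 'n Diff"
  have \<Psi>: "equivariant {..<?k} \<Psi>"
    using equivariant_s_std[of "[0..<?k]"] by (simp add: \<Psi>_def[abs_def] atLeast0LessThan)
  have "\<Psi> ((!) Xs) = 0"
  proof (rule eq_0_if_const_terms_eq_0[of "{..<?k}" \<Psi>])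
    fix a and \<beta> :: "'n \<Rightarrow>\<^sub>0 nat" assume a: "\<And>p. p \<in> {..<?k} \<Longrightarrow> a p \<in> range (monomial_field :: _ \<Rightarrow> 'n Diff)"
    let ?f = "Poly_Mapping.single \<beta> (1 :: complex)"
    have "a p = monomial_field (inv monomial_field (a p))" if "p < ?k" for p
      using a[of p] that by (simp add: f_inv_into_f)
    then obtain xs where xs: "map a [0..<?k] = map monomial_field xs" "length xs = ?k"
      by (intro that[of "map (\<lambda>p. inv monomial_field (a p)) [0..<?k]"]) simp_all
    show "const_term (Diff_apply (\<Psi> a) ?f) = 0"
    proof (cases "\<beta> = 0")
      case True
      have "Diff_apply (\<Psi> a) 1 = 0"
        unfolding \<Psi>_def by (rule s_std_apply_1) (use a k in \<open>force intro: Vect_apply_1\<close>)+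
      with True show ?thesis by simp
    next
      case False
      then have "mdeg \<beta> \<ge> 1" using mdeg_eq_0_iff[of \<beta>] by linarith
      show ?thesis
      proof (rule ccontr)
        assume "\<not> ?thesis"
        from const_term_s_std_monomial(3)[of xs \<beta>, OF this[unfolded \<Psi>_def xs(1)]]
        have "int ?k + int (mdeg \<beta>) \<le> (int CARD('n))\<^sup>2 + 2 * int CARD('n)"
          using sum_defect_le(1)[of "set xs"] xs(2) by simp
        moreover have "int ?k \<ge> (int CARD('n))\<^sup>2 + 2 * int CARD('n)"
          using len by (metis (mono_tags, lifting) of_nat_add of_nat_le_iff of_nat_mult of_nat_numeral of_nat_power)
        ultimately show False using \<open>mdeg \<beta> \<ge> 1\<close> by simp
      qed
    qed
  next
    fix a :: "nat \<Rightarrow> 'n Diff" and p assume "p \<in> {..<?k}"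
    then show "linear_op (\<lambda>x. \<Psi> (a(p := x)))" by (rule equivariant_linear[OF \<Psi>])
  next
    show "(!) Xs p \<in> Vect" if "p \<in> {..<?k}" for p using Xs that by auto
  qed (rule finite_lessThan, rule equivariant_ad[OF \<Psi>])
  then show ?thesis by (simp add: \<Psi>_def map_nth)
qed

section \<open>Left commutativity\<close>

text \<open>The arguments are \<open>a 1, \<dots>, a (2 * m - 1)\<close>, of which the last is
  the last argument of the inner operation.\<close>

definition nested_s_std :: "nat \<Rightarrow> (nat \<Rightarrow> 'n::finite Diff) \<Rightarrow> 'n Diff" where
  "nested_s_std m a = s_std (map a [1..<m] @ [s_std (map a [m..<2*m])])"

lemma equivariant_nested_s_std:
  assumes "m > 0"
  shows "equivariant {1..<2*m} (nested_s_std m :: (nat \<Rightarrow> 'n::finite Diff) \<Rightarrow> 'n Diff)"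
proof -
  have outer: "equivariant (insert m {1..<m}) (\<lambda>a :: nat \<Rightarrow> 'n Diff. s_std (map a [1..<Suc m]))"
    using equivariant_s_std[of "[1..<Suc m]"] assms by (simp add: atLeastLessThanSuc)
  have inner: "equivariant {m..<2*m} (\<lambda>a :: nat \<Rightarrow> 'n Diff. s_std (map a [m..<2*m]))"
    using equivariant_s_std[of "[m..<2*m]"] by simp
  have "equivariant ({1..<m} \<union> {m..<2*m})
      (\<lambda>a :: nat \<Rightarrow> 'n Diff. s_std (map (a(m := s_std (map a [m..<2*m]))) [1..<Suc m]))"
    by (rule equivariant_subst[OF outer inner]) auto
  moreover have "{1..<m} \<union> {m..<2*m} = {1..<2*m}" using assms by auto
  moreover have "s_std (map (a(m := s_std (map a [m..<2*m]))) [1..<Suc m]) = nested_s_std m a"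
    for a :: "nat \<Rightarrow> 'n Diff"
    using assms by (simp add: nested_s_std_def)
  ultimately show ?thesis by simp
qed

lemma has_degree_nested_s_std:
  assumes "m > 0" "\<And>p. p \<in> {1..<2*m} \<Longrightarrow> has_degree (e p) (a p)"
  shows "has_degree (\<Sum>p\<in>{1..<2*m}. e p) (nested_s_std m a)"
proof -
  have "list_all2 has_degree (map e [m..<2*m]) (map a [m..<2*m])"
    using assms by (auto simp: list_all2_map1 list_all2_map2 list_all2_same)
  then have "has_degree (sum_list (map e [m..<2*m])) (s_std (map a [m..<2*m]))"
    by (rule has_degree_s_std)
  moreover have "list_all2 has_degree (map e [1..<m]) (map a [1..<m])"
    using assms by (auto simp: list_all2_map1 list_all2_map2 list_all2_same)
  ultimately have "list_all2 has_degree (map e [1..<m] @ [sum_list (map e [m..<2*m])])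
      (map a [1..<m] @ [s_std (map a [m..<2*m])])"
    by (intro list_all2_appendI) simp_all
  from has_degree_s_std[OF this]
  have "has_degree (sum_list (map e [1..<m]) + sum_list (map e [m..<2*m])) (nested_s_std m a)"
    by (simp add: nested_s_std_def)
  also have "sum_list (map e [1..<m]) + sum_list (map e [m..<2*m]) = (\<Sum>p\<in>{1..<2*m}. e p)"
    using assms(1) by (simp add: sum_list_distinct_conv_sum_set sum.atLeastLessThan_concat)
  finally show ?thesis .
qed

lemma nested_s_std_apply_1:
  assumes "m > 0" "\<And>p. p \<in> {1..<2*m} \<Longrightarrow> a p \<in> Vect"
  shows "Diff_apply (nested_s_std m a) 1 = 0"
proof -
  have "Diff_apply (s_std (map a [m..<2*m])) 1 = 0"
    by (rule s_std_apply_1) (use assms in \<open>auto intro!: Vect_apply_1\<close>)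
  then show ?thesis
    unfolding nested_s_std_def
    by (intro s_std_apply_1) (use assms in \<open>auto simp: Vect_apply_1\<close>)
qed

text \<open>In a nonzero constant term the \<open>2 * m - 2\<close> skew-symmetric monomial
  arguments are distinct. Their degrees add up to at most \<open>0\<close>, because the last
  argument has degree at least \<open>- 1\<close> and the polynomial at least \<open>1\<close>.
  So many distinct fields with such a sum exceed the count.\<close>

lemma skew_sum_nested_s_std_eq_0:
  fixes a :: "nat \<Rightarrow> 'n::finite Diff"
  assumes m: "2 * m - 2 > CARD('n)\<^sup>2 + 2 * CARD('n)" and a: "\<And>p. p \<in> {1..<2*m} \<Longrightarrow> a p \<in> Vect"
  shows "skew_sum {1..2*m-2} (nested_s_std m) a = 0"
proof -
  let ?S = "{1..2*m-2}" and ?U = "{1..<2*m}"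
  have m0: "m > 0" using m by auto
  have U: "?U = insert (2*m-1) ?S" "2*m-1 \<notin> ?S" using m by auto
  have eq: "equivariant ?U (skew_sum ?S (nested_s_std m :: (nat \<Rightarrow> 'n Diff) \<Rightarrow> _))"
    by (rule equivariant_skew_sum[OF equivariant_nested_s_std]) (use m0 in auto)
  show ?thesis
  proof (rule eq_0_if_const_terms_eq_0[of ?U "skew_sum ?S (nested_s_std m)"])
    fix a and \<beta> :: "'n \<Rightarrow>\<^sub>0 nat" assume "\<And>p. p \<in> ?U \<Longrightarrow> a p \<in> range (monomial_field :: _ \<Rightarrow> 'n Diff)"
    then have "\<forall>p. \<exists>x. p \<in> ?U \<longrightarrow> a p = monomial_field x" by blast
    then obtain d where d: "\<And>p. p \<in> ?U \<Longrightarrow> a p = monomial_field (d p)" by metis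
    let ?f = "Poly_Mapping.single \<beta> (1 :: complex)"
    let ?e = "(\<Sum>p\<in>?U. field_degree (d p))"
    have perm: "\<sigma> p \<in> ?U \<longleftrightarrow> p \<in> ?U" if "\<sigma> permutes ?S" for \<sigma> p
      by (rule permutes_in_image[OF permutes_subset[OF that]]) auto
    show "const_term (Diff_apply (skew_sum ?S (nested_s_std m) a) ?f) = 0"
    proof (rule ccontr)
      assume nz: "\<not> ?thesis"
      \<comment> \<open>Distinctness is only forced for the skew-symmetric arguments, not for the last one.\<close>
      have inj: "inj_on d ?S"
      proof (rule inj_onI, rule ccontr)
        fix p q assume pq: "p \<in> ?S" "q \<in> ?S" "d p = d q" "p \<noteq> q"
        moreover from pq(1,2) have "p \<in> ?U" "q \<in> ?U" unfolding U(1) by blast+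
        ultimately have "a p = a q" by (simp only: d)
        with pq have "skew_sum ?S (nested_s_std m) a = 0"
          by (intro skew_sum_eq_0[of _ p q]) auto
        with nz show False by simp
      qed
      have "has_degree ?e (skew_sum ?S (nested_s_std m) a)"
        unfolding skew_sum_def of_int_mult_eq_scaleD
      proof (intro has_degree_sum has_degree_scaleD)
        fix \<sigma> assume "\<sigma> \<in> {\<sigma>. \<sigma> permutes ?S}"
        then have \<sigma>: "\<sigma> permutes ?S" by simp
        have "\<sigma> permutes ?U" by (rule permutes_subset[OF \<sigma>]) auto
        then have "?e = (\<Sum>p\<in>?U. field_degree (d (\<sigma> p)))"
          using sum.permute[of \<sigma> ?U "\<lambda>p. field_degree (d p)"] by (simp only: comp_def)
        also have "has_degree \<dots> (nested_s_std m (a \<circ> \<sigma>))"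
          using perm[OF \<sigma>] by (intro has_degree_nested_s_std m0) (simp add: d has_degree_monomial_field)
        finally show "has_degree ?e (nested_s_std m (a \<circ> \<sigma>))" .
      qed
      then have "homogeneous (int (mdeg \<beta>) + ?e) (Diff_apply (skew_sum ?S (nested_s_std m) a) ?f)"
        using homogeneous_single unfolding has_degree_def by blast
      with nz have deg: "int (mdeg \<beta>) + ?e = 0" using const_term_homogeneous by blast
      have "\<beta> \<noteq> 0"
      proof
        assume "\<beta> = 0"
        have "Diff_apply (nested_s_std m (a \<circ> \<sigma>)) 1 = 0" if "\<sigma> permutes ?S" for \<sigma>
          using perm[OF that] by (intro nested_s_std_apply_1 m0) (simp add: d)
        then have "Diff_apply (skew_sum ?S (nested_s_std m) a) 1 = 0"
          by (simp add: skew_sum_def of_int_mult_eq_scaleD)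
        with nz \<open>\<beta> = 0\<close> show False by simp
      qed
      then have "mdeg \<beta> \<ge> 1" using mdeg_eq_0_iff[of \<beta>] by linarith
      moreover have "?e = field_degree (d (2*m-1)) + (\<Sum>p\<in>?S. field_degree (d p))"
        unfolding U(1) by (rule sum.insert[OF _ U(2)]) simp
      moreover have "field_degree (d (2*m-1)) \<ge> - 1" by (simp add: field_degree_def)
      ultimately have "(\<Sum>p\<in>?S. field_degree (d p)) \<le> 0" using deg by linarith
      then have "int (2*m-2) \<le> (\<Sum>p\<in>?S. 1 - field_degree (d p))" by (simp add: sum_subtractf)
      also have "\<dots> = (\<Sum>x\<in>d ` ?S. 1 - field_degree x)" by (simp only: sum.reindex[OF inj] comp_def)
      also have "\<dots> \<le> (int CARD('n))\<^sup>2 + 2 * int CARD('n)" by (rule sum_defect_le(1)) simp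
      also have "\<dots> = int (CARD('n)\<^sup>2 + 2 * CARD('n))" by simp
      finally show False using m by linarith
    qed
  next
    fix a :: "nat \<Rightarrow> 'n Diff" and p assume "p \<in> ?U"
    then show "linear_op (\<lambda>x. skew_sum ?S (nested_s_std m) (a(p := x)))"
      by (rule equivariant_linear[OF eq])
  qed (rule finite_atLeastLessThan, rule equivariant_ad[OF eq], rule a)
qed

lemma left_commutative_sum_eq:
  assumes "m > 0"
  shows "(\<Sum>\<sigma> | \<sigma> permutes {1..2*m-2}.
           scaleD (of_int (sign \<sigma>))
             (s_std (map (\<lambda>i. a (\<sigma> i)) [1..<m] @
                 [s_std (map (\<lambda>i. a (\<sigma> i)) [m..<2*m-1] @ [a (2*m-1)])])))
       = skew_sum {1..2*m-2} (nested_s_std m) a"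
proof -
  have range: "[m..<2*m] = [m..<2*m-1] @ [2*m-1]"
    using upt_Suc_append[of m "2*m-1"] assms by simp
  have fixed: "\<sigma> (2*m-1) = 2*m-1" if "\<sigma> permutes {1..2*m-2}" for \<sigma>
    by (rule permutes_not_in[OF that]) (use assms in auto)
  have "map (a \<circ> \<sigma>) [m..<2*m] = map (\<lambda>i. a (\<sigma> i)) [m..<2*m-1] @ [a (2*m-1)]"
    if "\<sigma> permutes {1..2*m-2}" for \<sigma>
    by (simp only: range map_append list.map comp_def fixed[OF that])
  then show ?thesis
    unfolding skew_sum_def nested_s_std_def of_int_mult_eq_scaleD
    by (intro sum.cong) (simp_all add: comp_def del: One_nat_def)
qed

text \<open>The permutations of all arguments are grouped by the one that comes last; each group
  gives a left commutativity sum.\<close>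

lemma homotopical_lie_if_left_commutative:
  fixes \<omega> :: "'n::finite Diff list \<Rightarrow> 'n Diff"
  assumes "left_commutative scaleD A m \<omega>" "m > 0"
  shows "homotopical_lie scaleD A m \<omega>"
  unfolding homotopical_lie_def
proof (intro conjI allI impI)
  show "k_algebra scaleD A m \<omega>" "skew_symmetric_on scaleD A m \<omega>"
    using assms(1) by (simp_all add: left_commutative_def)
  fix a :: "nat \<Rightarrow> 'n Diff" assume a: "a ` {1..2*m-1} \<subseteq> A"
  let ?F = "\<lambda>b. \<omega> (map b [1..<m] @ [\<omega> (map b [m..<2*m-1] @ [b (2*m-1)])])"
  let ?S = "{1..2*m-2}"
  have U: "{1..2*m-1} = insert (2*m-1) ?S" "2*m-1 \<notin> ?S" using assms(2) by auto
  have fixed: "\<sigma> (2*m-1) = 2*m-1" if "\<sigma> permutes ?S" for \<sigma>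
    by (rule permutes_not_in[OF that U(2)])
  have lc: "(\<Sum>\<sigma> | \<sigma> permutes ?S. scaleD (of_int (sign \<sigma>)) (?F (b \<circ> \<sigma>))) = 0" if "b ` {1..2*m-1} \<subseteq> A" for b
  proof -
    have "(\<Sum>\<sigma> | \<sigma> permutes ?S. scaleD (of_int (sign \<sigma>)) (?F (b \<circ> \<sigma>)))
        = (\<Sum>\<sigma> | \<sigma> permutes ?S. scaleD (of_int (sign \<sigma>))
             (\<omega> (map (\<lambda>i. b (\<sigma> i)) [1..<m] @ [\<omega> (map (\<lambda>i. b (\<sigma> i)) [m..<2*m-1] @ [b (2*m-1)])])))"
      by (intro sum.cong) (simp_all add: fixed comp_def del: One_nat_def)
    then show ?thesis using assms(1) that unfolding left_commutative_def by simp
  qed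
  let ?G = "\<lambda>\<sigma>. scaleD (of_int (sign \<sigma>)) (?F (a \<circ> \<sigma>))"
  have zero: "(\<Sum>\<sigma> | \<sigma> permutes ?S.
      scaleD (of_int (sign (Transposition.transpose (2*m-1) p \<circ> \<sigma>))) (?F (a \<circ> (Transposition.transpose (2*m-1) p \<circ> \<sigma>)))) = 0"
    if p: "p \<in> {1..2*m-1}" for p
  proof -
    let ?t = "Transposition.transpose (2*m-1) p"
    have t: "?t permutes {1..2*m-1}" using p U by (intro permutes_swap_id) auto
    have "permutation \<sigma>" if "\<sigma> permutes ?S" for \<sigma> using that by (auto simp: permutation_permutes)
    then have "(\<Sum>\<sigma> | \<sigma> permutes ?S. scaleD (of_int (sign (?t \<circ> \<sigma>))) (?F (a \<circ> (?t \<circ> \<sigma>))))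
        = scaleD (of_int (sign ?t)) (\<Sum>\<sigma> | \<sigma> permutes ?S. scaleD (of_int (sign \<sigma>)) (?F ((a \<circ> ?t) \<circ> \<sigma>)))"
      by (simp add: sign_compose permutation_swap_id Diff.scale_sum_right comp_assoc)
    also have "(\<Sum>\<sigma> | \<sigma> permutes ?S. scaleD (of_int (sign \<sigma>)) (?F ((a \<circ> ?t) \<circ> \<sigma>))) = 0"
      by (rule lc) (use a permutes_image[OF t] in \<open>simp only: image_comp[symmetric]\<close>)
    finally show ?thesis by (simp only: Diff.scale_zero_right)
  qed
  have "(\<Sum>\<sigma> | \<sigma> permutes {1..2*m-1}. ?G \<sigma>)
      = (\<Sum>p\<in>{1..2*m-1}. \<Sum>\<sigma> | \<sigma> permutes ?S. ?G (Transposition.transpose (2*m-1) p \<circ> \<sigma>))"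
    unfolding U(1) by (rule sum_over_permutations_insert[OF _ U(2)]) simp
  also have "\<dots> = 0"
    by (rule sum.neutral) (intro ballI zero)
  finally show "(\<Sum>\<sigma> | \<sigma> permutes {1..2*m-1}.
           scaleD (of_int (sign \<sigma>))
             (\<omega> (map (\<lambda>i. a (\<sigma> i)) [1..<m] @
                 [\<omega> (map (\<lambda>i. a (\<sigma> i)) [m..<2*m-1] @ [a (\<sigma> (2*m-1))])]))) = 0"
    by (simp add: comp_def)
qed

section \<open>Algebras of vector fields\<close>

lemma Vect_list_update: "set Xs \<subseteq> Vect \<Longrightarrow> X \<in> Vect \<Longrightarrow> set (Xs[i := X]) \<subseteq> Vect"
  using set_update_subset_insert[of Xs i X] by blast

lemma linear_map_on_if_linear_op:
  assumes F: "linear_op F" and "F ` A \<subseteq> A"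
  shows "linear_map_on scaleD A F"
  using assms(2) by (simp add: linear_map_on_def linear_op_add[OF F] linear_op_scale[OF F])

lemma linear_map_on_cong:
  assumes "Diff.subspace A" "\<And>x. x \<in> A \<Longrightarrow> F x = G x"
  shows "linear_map_on scaleD A F \<longleftrightarrow> linear_map_on scaleD A G"
  using assms(2) Diff.subspace_add[OF assms(1)] Diff.subspace_scale[OF assms(1)]
  by (simp add: linear_map_on_def image_subset_iff)

lemma linear_map_on_ad: "X \<in> Vect \<Longrightarrow> linear_map_on scaleD Vect (ad X)"
  by (rule linear_map_on_if_linear_op[OF linear_op_ad]) (auto intro: ad_in_Vect)

lemma k_algebra_s_std:
  assumes "\<And>Xs :: 'n::finite Diff list. length Xs = k \<Longrightarrow> set Xs \<subseteq> Vect \<Longrightarrow> s_std Xs \<in> Vect"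
  shows "k_algebra scaleD (Vect :: 'n Diff set) k s_std"
  unfolding k_algebra_def
proof (intro conjI allI impI subspace_Vect)
  fix Xs :: "'n Diff list" assume Xs: "length Xs = k \<and> set Xs \<subseteq> Vect"
  then show "s_std Xs \<in> Vect" using assms by blast
  fix i assume "i < k"
  then have "linear_op (\<lambda>x. s_std (Xs[i := x]))" using Xs by (simp add: linear_op_s_std)
  moreover have "s_std (Xs[i := x]) \<in> Vect" if "x \<in> Vect" for x
    using Xs that by (intro assms Vect_list_update) simp_all
  ultimately show "linear_map_on scaleD Vect (\<lambda>x. s_std (Xs[i := x]))"
    by (intro linear_map_on_if_linear_op) auto
qed

lemma k_algebra_s_rsym:
  assumes "k > 0"
  shows "k_algebra scaleD (Vect :: 'n::finite Diff set) k s_rsym"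
  unfolding k_algebra_def
proof (intro conjI allI impI subspace_Vect)
  fix Xs :: "'n Diff list" assume Xs: "length Xs = k \<and> set Xs \<subseteq> Vect"
  then have "Xs \<noteq> []" using assms by auto
  with Xs show "s_rsym Xs \<in> Vect" by (simp add: s_rsym_eq_first_order)
  fix i assume "i < k"
  with Xs have lin: "linear_op (\<lambda>x. s_std (Xs[i := x]))" by (simp add: linear_op_s_std)
  have "linear_op (\<lambda>x. first_order (s_std (Xs[i := x])))"
    by (rule linear_opI)
       (simp_all add: linear_op_add[OF lin] linear_op_scale[OF lin]
          linear_op_add[OF linear_op_first_order] linear_op_scale[OF linear_op_first_order])
  then have "linear_map_on scaleD Vect (\<lambda>x. first_order (s_std (Xs[i := x])))"
    by (rule linear_map_on_if_linear_op) auto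
  then show "linear_map_on scaleD Vect (\<lambda>x. s_rsym (Xs[i := x]))"
  proof (rule linear_map_on_cong[OF subspace_Vect, THEN iffD2, rotated])
    fix x :: "'n Diff" assume "x \<in> Vect"
    then show "s_rsym (Xs[i := x]) = first_order (s_std (Xs[i := x]))"
      using \<open>Xs \<noteq> []\<close> Xs by (intro s_rsym_eq_first_order Vect_list_update) auto
  qed
qed

lemma derivation_on_s_std:
  assumes "k_algebra scaleD (Vect :: 'n::finite Diff set) k s_std" "X \<in> (Vect :: 'n Diff set)"
  shows "derivation_on scaleD Vect k s_std (ad X)"
  unfolding derivation_on_def
proof (intro conjI allI impI assms(1) linear_map_on_ad[OF assms(2)])
  fix Xs :: "'n Diff list" assume "length Xs = k \<and> set Xs \<subseteq> Vect"
  then show "ad X (s_std Xs) = (\<Sum>i<k. s_std (Xs[i := ad X (Xs ! i)]))"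
    using ad_s_std[of X Xs] by simp
qed

lemma derivation_on_s_rsym:
  assumes "k > 0" and u: "\<And>i j l. pd i (pd j (u l)) = 0"
  shows "derivation_on scaleD Vect k s_rsym (ad (vf u))"
  unfolding derivation_on_def
proof (intro conjI allI impI k_algebra_s_rsym linear_map_on_ad vf_in_Vect assms(1))
  fix Xs :: "'a Diff list" assume Xs: "length Xs = k \<and> set Xs \<subseteq> Vect"
  then have ne: "Xs \<noteq> []" using assms(1) by auto
  let ?X = "vf u"
  have 1: "Diff_apply (s_std Xs) 1 = 0"
    by (rule s_std_apply_1) (use ne Xs in \<open>auto intro: Vect_apply_1\<close>)
  have "ad ?X (s_rsym Xs) = first_order (ad ?X (s_std Xs))"
    using ne Xs by (simp add: s_rsym_eq_first_order first_order_ad_affine[OF u 1])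
  also have "\<dots> = (\<Sum>i<k. first_order (s_std (Xs[i := ad ?X (Xs ! i)])))"
    using Xs by (simp add: ad_s_std Diff_pair.linear_sum[OF linear_op_first_order])
  also have "\<dots> = (\<Sum>i<k. s_rsym (Xs[i := ad ?X (Xs ! i)]))"
  proof (rule sum.cong)
    fix i assume "i \<in> {..<k}"
    then have "ad ?X (Xs ! i) \<in> Vect" using Xs by (intro ad_in_Vect) auto
    then show "first_order (s_std (Xs[i := ad ?X (Xs ! i)])) = s_rsym (Xs[i := ad ?X (Xs ! i)])"
      using ne Xs by (intro s_rsym_eq_first_order[symmetric] Vect_list_update) auto
  qed simp
  finally show "ad ?X (s_rsym Xs) = (\<Sum>i<k. s_rsym (Xs[i := ad ?X (Xs ! i)]))" .
qed

theorem theorem3p1: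
  fixes n N :: nat
  assumes "n = CARD('n::finite)" and "N = n^2 + 2*n - 2"
  shows
    "(\<forall>k\<ge>N. \<forall>Xs::'n Diff list. length Xs = k \<and> set Xs \<subseteq> Vect \<longrightarrow>
        s_std Xs = s_rsym Xs \<and> s_std Xs \<in> Vect) \<and>
     (\<forall>k>N+1. \<forall>Xs::'n Diff list. length Xs = k \<and> set Xs \<subseteq> Vect \<longrightarrow> s_std Xs = 0) \<and>
     (n > 1 \<longrightarrow>
        left_commutative scaleD (Vect :: 'n Diff set) N s_std \<and>
        homotopical_lie scaleD (Vect :: 'n Diff set) N s_std) \<and>
     (\<forall>X\<in>(Vect :: 'n Diff set). \<forall>k\<ge>N. derivation_on scaleD Vect k s_std (ad X)) \<and>
     (\<forall>k>0. \<forall>u :: 'n \<Rightarrow> 'n U. (\<forall>i j l. pd i (pd j (u l)) = 0) \<longrightarrow>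
        derivation_on scaleD Vect k s_rsym (ad (vf u)))"
proof -
  \<comment> \<open>As \<open>n \<ge> 1\<close>, the subtraction in \<open>N\<close> is not truncated, and no argument list is empty.\<close>
  have "CARD('n) \<ge> 1" by (simp add: Suc_leI)
  then have n: "n \<ge> 1" unfolding assms(1) .
  then have "n^2 \<ge> 1" by simp
  with n assms(2) have N': "N + 2 = n^2 + 2 * n" "N \<ge> 1" by linarith+
  then have N: "N + 2 = CARD('n)^2 + 2 * CARD('n)" "N \<ge> 1" by (simp_all add: assms(1))
  have i: "s_std Xs = s_rsym Xs \<and> s_std Xs \<in> Vect" if "length Xs \<ge> N" "set Xs \<subseteq> Vect"
    for Xs :: "'n Diff list"
  proof -
    have "Xs \<noteq> []" using that(1) N(2) by auto
    then have "s_rsym Xs = first_order (s_std Xs)" using that(2) by (rule s_rsym_eq_first_order)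
    moreover have "s_std Xs = first_order (s_std Xs)"
      by (rule s_std_eq_first_order) (use that N in auto)
    ultimately show ?thesis by (metis first_order_in_Vect)
  qed
  have alg: "k_algebra scaleD (Vect :: 'n Diff set) k s_std" if "k \<ge> N" for k
    by (rule k_algebra_s_std) (use i that in blast)
  have lc: "left_commutative scaleD (Vect :: 'n Diff set) N s_std" if "n > 1"
    unfolding left_commutative_def
  proof (intro conjI allI impI alg order_refl)
    show "skew_symmetric_on scaleD (Vect :: 'n Diff set) N s_std"
      by (auto simp: skew_symmetric_on_def s_std_permute of_int_mult_eq_scaleD)
    fix a :: "nat \<Rightarrow> 'n Diff" assume a: "a ` {1..2*N-1} \<subseteq> Vect"
    have "n^2 \<ge> 2 * n" using that by (simp add: power2_eq_square)
    then have "2 * N - 2 > n^2 + 2 * n" using that N' by linarith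
    then have "skew_sum {1..2*N-2} (nested_s_std N) a = 0"
      using a assms(1) by (intro skew_sum_nested_s_std_eq_0) auto
    then show "(\<Sum>\<sigma> | \<sigma> permutes {1..2*N-2}.
           scaleD (of_int (sign \<sigma>))
             (s_std (map (\<lambda>i. a (\<sigma> i)) [1..<N] @
                 [s_std (map (\<lambda>i. a (\<sigma> i)) [N..<2*N-1] @ [a (2*N-1)])]))) = 0"
      using N(2) by (subst left_commutative_sum_eq) simp_all
  qed
  have ii: "s_std Xs = 0" if "length Xs > N + 1" "set Xs \<subseteq> Vect" for Xs :: "'n Diff list"
    by (rule s_std_eq_0) (use that N in auto)
  show ?thesis
  proof (intro conjI allI impI ballI)
    show "left_commutative scaleD (Vect :: 'n Diff set) N s_std" if "n > 1"
      using that by (rule lc)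
    then show "homotopical_lie scaleD (Vect :: 'n Diff set) N s_std" if "n > 1"
      using that N(2) by (intro homotopical_lie_if_left_commutative) auto
    show "derivation_on scaleD Vect k s_std (ad X)" if "X \<in> Vect" "k \<ge> N" for k and X :: "'n Diff"
      using alg[OF that(2)] that(1) by (rule derivation_on_s_std)
    show "derivation_on scaleD Vect k s_rsym (ad (vf u))"
      if "k > 0" "\<forall>i j l. pd i (pd j (u l)) = 0" for k and u :: "'n \<Rightarrow> 'n U"
      using that by (intro derivation_on_s_rsym) simp_all
  qed (use i ii in blast)+
qed

end
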